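(* Let $F$ be the skew product over the three-legged horseshoe with fiber maps $f_0,f_1,f_2$ described in the context, satisfying (F0), (F1), (F2), (F01) and (F012), and let $\Lambda$ be its maximal invariant set. If $\gamma\,(\beta_{02}^+)^2<1$, then the measure of maximal entropy of $F|_\Lambda$ is unique and has negative central Lyapunov exponent.
   Context: **Base.** $\Phi$ is a diffeomorphism of $\mathbb R^2$ having a horseshoe $\Gamma\subset\widehat{\mathbf C}=[0,1]^2$ and a homeomorphism $\varpi:\Gamma\to\Sigma_3=\{0,1,2\}^{\mathbb Z}$ with $\varpi\circ\Phi=\sigma\circ\varpi$, $\sigma$ the full shift. $\widehat{\mathbf C}_0,\widehat{\mathbf C}_1,\widehat{\mathbf C}_2$ are the three associated pairwise disjoint sub-rectangles of $\widehat{\mathbf C}$ ($\Gamma$ is the maximal invariant set of $\Phi$ in their union, and $X\in\Gamma$ lies in $\widehat{\mathbf C}_i$ iff the $0$-th symbol of $\varpi(X)$ is $i$). $\Phi$ is affine on each $\widehat{\mathbf C}_i$, contracting the first coordinate direction and expanding the second. **Skew product.** $\mathbf C=[0,1]^3$ and $F(\widehat x,x)=(\Phi(\widehat x),f_i(x))$ if $(\widehat x,x)\in\widehat{\mathbf C}_i\times[0,1]$, where $f_0,f_1,f_2:[0,1]\to[0,1]$ are $C^1$ injective maps. The expansion (contraction) of $\Phi$ is stronger than any expansion (contraction) of the $f_i$ (in particular $f_i'$ never vanishes), so that the $DF$-invariant splitting $E^{ss}\oplus E^c\oplus E^{uu}$ into the first, third and second coordinate directions is dominated. $\Lambda=\bigcap_{i\in\mathbb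 Z}F^i(\mathbf C)$, the set of points with complete $F$-orbit in $\mathbf C$. (The topological entropy of $F|_\Lambda$ is $\log3$.) **Fiber maps.** (F0) $f_0$ is increasing with exactly two fixed points, both hyperbolic: $0$ (repelling) and $1$ (attracting); $\beta_0=f_0'(0)>1$, $\lambda_0=f_0'(1)\in(0,1)$, and $\lambda_0\le f_0'(x)$ for all $x\in[0,1]$. (F1) $f_1(x)=\gamma(1-x)$ is a contraction, $\lambda_0\le\gamma<1$. (F2) $f_2$ is increasing and has two hyperbolic fixed points, $0$ (repelling) and a point $p_2\in(0,1)$ (attracting); $\beta_2=f_2'(0)>1$. (F01) $f_0'$ is decreasing on $[0,1]$ and $\gamma\,\frac{\lambda_0^3(1-\lambda_0)}{1-\beta_0^{-1}}>1$. Put $\beta_{02}^-=\min\{\beta_0,\beta_2\}$, $\beta_{02}^+=\max\{\beta_0,\beta_2\}$. (F012) $f_0'(x),f_2'(x)\le\beta_{02}^+$ for all $x\in[0,1]$. There is an interval $H=[0,\delta]$, $\delta>0$, such that $H$ and $H'=f_1^{-1}(H)$ satisfy $f_1(H)\cap H=\emptyset$, $f_1(H')\cap H'=\emptyset$, $f_1([0,1])\cap H'=\emptyset$, $f_2([0,1])\cap H'=\emptyset$. Moreover $\beta'=\max\{f_0'(x),f_2'(x):x\notin H\}<\beta_{02}^-$; $\beta_H=\min\{f_0'(x),f_2'(x):x\in H\}$ satisfies $1<\beta_H<\beta_{02}^-$; $\lambda'=\max\{f_0'(x):x\in H'\}<1$; $$|\log\lambda_0|\frac{\log\beta_{02}^+}{\log\beta_H}-|\log\lambda'|+\tfrac23\log\beta_{02}^+<\tfrac34\log\beta';$$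 and there is $L\ge1$ with $L>4\frac{|\log\lambda_0|\log\beta_{02}^+}{\log\beta_H\log\beta'}$ and $\frac{\log((\beta_{02}^+)^L\gamma)}{L+1}<\log\beta'$. **Notation.** A measure of maximal entropy is an $F$-invariant Borel probability $\mu$ on $\Lambda$ whose entropy equals the topological entropy of $F|_\Lambda$. Its central Lyapunov exponent is $\int\log\lVert dF|_{E^c}\rVert\,d\mu$. *)

theory Defs
  imports "HOL-Probability.Probability"
begin

type_synonym plane = "real \<times> real"


section \<open>Diffeomorphisms, maximal invariant sets and entropy\<close>

definition C1_map :: "(plane \<Rightarrow> plane) \<Rightarrow> bool" where
  "C1_map g \<longleftrightarrow> (\<exists>g' :: plane \<Rightarrow> plane \<Rightarrow>\<^sub>L plane.
     (\<forall>x. (g has_derivative blinfun_apply (g' x)) (at x)) \<and> continuous_on UNIV g')"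

definition C1_diffeomorphism :: "(plane \<Rightarrow> plane) \<Rightarrow> bool" where
  "C1_diffeomorphism g \<longleftrightarrow> bij g \<and> C1_map g \<and> C1_map (inv g)"

text \<open>For a map \<open>T\<close> that is meaningful on \<open>D\<close> only: the points with a complete (two-sided)
  \<open>T\<close>-orbit inside \<open>D\<close>.  If \<open>T\<close> is injective on \<open>D\<close>, this is the intersection of all forward
  and backward iterates of \<open>D\<close> under the partial map.\<close>

definition maximal_invariant_set :: "('a \<Rightarrow> 'a) \<Rightarrow> 'a set \<Rightarrow> 'a set" where
  "maximal_invariant_set T D =
     {p. \<exists>z :: int \<Rightarrow> 'a. z 0 = p \<and> (\<forall>n. z n \<in> D \<and> z (n + 1) = T (z n))}"

text \<open>Topological entropy of \<open>T\<close> restricted to an invariant compact set \<open>K\<close>, by Bowen's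
  \<open>(n, \<epsilon>)\<close>-spanning sets.\<close>

definition spanning_number :: "('a :: metric_space \<Rightarrow> 'a) \<Rightarrow> 'a set \<Rightarrow> nat \<Rightarrow> real \<Rightarrow> nat" where
  "spanning_number T K n \<epsilon> = Inf {card E | E. E \<subseteq> K \<and> finite E \<and>
     (\<forall>x\<in>K. \<exists>y\<in>E. \<forall>i<n. dist ((T ^^ i) x) ((T ^^ i) y) < \<epsilon>)}"

definition topological_entropy :: "('a :: metric_space \<Rightarrow> 'a) \<Rightarrow> 'a set \<Rightarrow> ereal" where
  "topological_entropy T K =
     (SUP \<epsilon>\<in>{0<..}. limsup (\<lambda>n. ereal (ln (real (spanning_number T K n \<epsilon>)) / real n)))"

text \<open>Kolmogorov--Sinai entropy.  The convention \<open>0 log 0 = 0\<close> holds since \<open>ln 0 = 0\<close>; the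
  limit of the normalised entropies exists by subadditivity, so that \<open>limsup\<close> is that limit.\<close>

definition finite_measurable_partition :: "'a measure \<Rightarrow> 'a set set \<Rightarrow> bool" where
  "finite_measurable_partition M P \<longleftrightarrow> finite P \<and> P \<subseteq> sets M \<and> partition_on (space M) P"

definition partition_entropy :: "'a measure \<Rightarrow> 'a set set \<Rightarrow> real" where
  "partition_entropy M P = - (\<Sum>A\<in>P. measure M A * ln (measure M A))"

definition iterated_join :: "'a measure \<Rightarrow> ('a \<Rightarrow> 'a) \<Rightarrow> 'a set set \<Rightarrow> nat \<Rightarrow> 'a set set" where
  "iterated_join M T P n =
     {{x \<in> space M. \<forall>i<n. (T ^^ i) x \<in> A i} | A. \<forall>i<n. A i \<in> P}"

definition metric_entropy :: "'a measure \<Rightarrow> ('a \<Rightarrow> 'a) \<Rightarrow> ereal" where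
  "metric_entropy M T =
     (SUP P\<in>{P. finite_measurable_partition M P}.
        limsup (\<lambda>n. ereal (partition_entropy M (iterated_join M T P n) / real n)))"

definition invariant_borel_probability ::
    "('a :: topological_space \<Rightarrow> 'a) \<Rightarrow> 'a set \<Rightarrow> 'a measure \<Rightarrow> bool" where
  "invariant_borel_probability T K \<mu> \<longleftrightarrow>
     prob_space \<mu> \<and> space \<mu> = K \<and> sets \<mu> = sets (restrict_space borel K) \<and>
     T \<in> measurable \<mu> \<mu> \<and> distr \<mu> \<mu> T = \<mu>"

definition measure_of_maximal_entropy ::
    "('a :: metric_space \<Rightarrow> 'a) \<Rightarrow> 'a set \<Rightarrow> 'a measure \<Rightarrow> bool" where
  "measure_of_maximal_entropy T K \<mu> \<longleftrightarrow>
     invariant_borel_probability T K \<mu> \<and> metric_entropy \<mu> T = topological_entropy T K"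


section \<open>The horseshoe in the base\<close>

definition full_shift_space :: "(int \<Rightarrow> nat) set" where
  "full_shift_space = {\<omega>. \<forall>n. \<omega> n < 3}"

definition shift :: "(int \<Rightarrow> nat) \<Rightarrow> int \<Rightarrow> nat" where
  "shift \<omega> = (\<lambda>n. \<omega> (n + 1))"

definition rectangle :: "plane set \<Rightarrow> bool" where
  "rectangle Q \<longleftrightarrow> (\<exists>a b c d. a < b \<and> c < d \<and> Q = {a..b} \<times> {c..d})"

text \<open>\<open>R 0\<close>, \<open>R 1\<close>, \<open>R 2\<close> are the sub-rectangles, \<open>\<pi>\<close> is the coding of the horseshoe \<open>\<Gamma>\<close>, and
  \<open>cs i\<close>, \<open>ex i\<close> are the linear parts of the diagonal affine map \<open>\<Phi>\<close> on \<open>R i\<close>.  The topology on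
  sequences is the product of the discrete topologies.\<close>

definition three_legged_horseshoe ::
    "(plane \<Rightarrow> plane) \<Rightarrow> (nat \<Rightarrow> plane set) \<Rightarrow> plane set \<Rightarrow> (plane \<Rightarrow> int \<Rightarrow> nat)
      \<Rightarrow> (nat \<Rightarrow> real) \<Rightarrow> (nat \<Rightarrow> real) \<Rightarrow> bool" where
  "three_legged_horseshoe \<Phi> R \<Gamma> \<pi> cs ex \<longleftrightarrow>
     C1_diffeomorphism \<Phi> \<and>
     (\<forall>i<3. rectangle (R i) \<and> R i \<subseteq> {0..1} \<times> {0..1}) \<and>
     (\<forall>i<3. \<forall>j<3. i \<noteq> j \<longrightarrow> R i \<inter> R j = {}) \<and>
     \<Gamma> = maximal_invariant_set \<Phi> (\<Union>i<3. R i) \<and>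
     (\<exists>\<pi>'. homeomorphism \<Gamma> full_shift_space \<pi> \<pi>') \<and>
     (\<forall>X\<in>\<Gamma>. \<pi> (\<Phi> X) = shift (\<pi> X)) \<and>
     (\<forall>X\<in>\<Gamma>. \<forall>i<3. X \<in> R i \<longleftrightarrow> \<pi> X 0 = i) \<and>
     (\<forall>i<3. 0 < \<bar>cs i\<bar> \<and> \<bar>cs i\<bar> < 1 \<and> 1 < \<bar>ex i\<bar> \<and>
        (\<exists>s t. \<forall>(u, v)\<in>R i. \<Phi> (u, v) = (cs i * u + s, ex i * v + t)))"


section \<open>The skew product\<close>

text \<open>Throughout, \<open>df i\<close> is the derivative of \<open>f i\<close> on \<open>[0,1]\<close> (one-sided at the end points).\<close>

definition C1_fiber_maps :: "(nat \<Rightarrow> real \<Rightarrow> real) \<Rightarrow> (nat \<Rightarrow> real \<Rightarrow> real) \<Rightarrow> bool" where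
  "C1_fiber_maps f df \<longleftrightarrow>
     (\<forall>i<3. f i ` {0..1} \<subseteq> {0..1} \<and> inj_on (f i) {0..1} \<and>
        (\<forall>x\<in>{0..1}. (f i has_real_derivative df i x) (at x within {0..1})) \<and>
        continuous_on {0..1} (df i))"

definition dominated_fibers ::
    "(nat \<Rightarrow> real) \<Rightarrow> (nat \<Rightarrow> real) \<Rightarrow> (nat \<Rightarrow> real \<Rightarrow> real) \<Rightarrow> bool" where
  "dominated_fibers cs ex df \<longleftrightarrow>
     (\<forall>i<3. \<forall>j<3. \<forall>x\<in>{0..1}. \<bar>cs i\<bar> < \<bar>df j x\<bar> \<and> \<bar>df j x\<bar> < \<bar>ex i\<bar>)"

text \<open>The skew product is meant to be defined on \<open>skew_domain R\<close> only; there the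
  index of the rectangle is unique.\<close>

definition skew_domain :: "(nat \<Rightarrow> plane set) \<Rightarrow> (plane \<times> real) set" where
  "skew_domain R = (\<Union>i<3. R i) \<times> {0..1}"

definition skew_product ::
    "(plane \<Rightarrow> plane) \<Rightarrow> (nat \<Rightarrow> plane set) \<Rightarrow> (nat \<Rightarrow> real \<Rightarrow> real)
      \<Rightarrow> plane \<times> real \<Rightarrow> plane \<times> real" where
  "skew_product \<Phi> R f = (\<lambda>(X, x). (\<Phi> X, f (THE i. i < 3 \<and> X \<in> R i) x))"

text \<open>\<open>E\<^sup>c\<close> is the fiber direction, so that \<open>\<parallel>dF|E\<^sup>c\<parallel>\<close> at \<open>(X, x)\<close> is the norm of the derivative of
  \<open>F\<close> along the fiber through \<open>(X, x)\<close>.\<close>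

definition central_derivative_norm :: "(plane \<times> real \<Rightarrow> plane \<times> real) \<Rightarrow> plane \<times> real \<Rightarrow> real" where
  "central_derivative_norm F =
     (\<lambda>(X, x). norm (vector_derivative (\<lambda>t. F (X, t)) (at x within {0..1})))"

definition central_lyapunov_exponent ::
    "(plane \<times> real \<Rightarrow> plane \<times> real) \<Rightarrow> (plane \<times> real) measure \<Rightarrow> real" where
  "central_lyapunov_exponent F \<mu> = (LINT p|\<mu>. ln (central_derivative_norm F p))"


section \<open>Hypotheses on the fiber maps\<close>

definition cond_F0 :: "(nat \<Rightarrow> real \<Rightarrow> real) \<Rightarrow> (nat \<Rightarrow> real \<Rightarrow> real) \<Rightarrow> bool" where
  "cond_F0 f df \<longleftrightarrow>
     strict_mono_on {0..1} (f 0) \<and>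
     (\<forall>x\<in>{0..1}. f 0 x = x \<longleftrightarrow> x = 0 \<or> x = 1) \<and>
     df 0 0 > 1 \<and> 0 < df 0 1 \<and> df 0 1 < 1 \<and>
     (\<forall>x\<in>{0..1}. df 0 1 \<le> df 0 x)"

definition cond_F1 :: "(nat \<Rightarrow> real \<Rightarrow> real) \<Rightarrow> (nat \<Rightarrow> real \<Rightarrow> real) \<Rightarrow> real \<Rightarrow> bool" where
  "cond_F1 f df \<gamma> \<longleftrightarrow>
     (\<forall>x\<in>{0..1}. f 1 x = \<gamma> * (1 - x)) \<and> df 0 1 \<le> \<gamma> \<and> \<gamma> < 1"

definition cond_F2 :: "(nat \<Rightarrow> real \<Rightarrow> real) \<Rightarrow> (nat \<Rightarrow> real \<Rightarrow> real) \<Rightarrow> bool" where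
  "cond_F2 f df \<longleftrightarrow>
     strict_mono_on {0..1} (f 2) \<and>
     f 2 0 = 0 \<and> df 2 0 > 1 \<and>
     (\<exists>p. 0 < p \<and> p < 1 \<and> f 2 p = p \<and> 0 < df 2 p \<and> df 2 p < 1)"

definition cond_F01 :: "(nat \<Rightarrow> real \<Rightarrow> real) \<Rightarrow> real \<Rightarrow> bool" where
  "cond_F01 df \<gamma> \<longleftrightarrow>
     antimono_on {0..1} (df 0) \<and>
     (let \<beta>\<^sub>0 = df 0 0; l\<^sub>0 = df 0 1
      in \<gamma> * (l\<^sub>0 ^ 3 * (1 - l\<^sub>0) / (1 - inverse \<beta>\<^sub>0)) > 1)"

definition beta_min :: "(nat \<Rightarrow> real \<Rightarrow> real) \<Rightarrow> real" where
  "beta_min df = min (df 0 0) (df 2 0)"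

definition beta_max :: "(nat \<Rightarrow> real \<Rightarrow> real) \<Rightarrow> real" where
  "beta_max df = max (df 0 0) (df 2 0)"

text \<open>\<open>\<beta>'\<close> is taken over the half-open interval \<open>(\<delta>, 1]\<close>, where a maximum need not be attained,
  whence \<open>Sup\<close>.  The fraction with denominator \<open>ln \<beta>\<^sub>H * ln \<beta>'\<close> is a genuine one: by continuity of
  the derivatives at \<open>\<delta>\<close>, \<open>\<beta>' \<ge> \<beta>\<^sub>H > 1\<close>.  The number \<open>L\<close> is real.\<close>

definition cond_F012 :: "(nat \<Rightarrow> real \<Rightarrow> real) \<Rightarrow> (nat \<Rightarrow> real \<Rightarrow> real) \<Rightarrow> real \<Rightarrow> bool" where
  "cond_F012 f df \<gamma> \<longleftrightarrow>
     (\<forall>x\<in>{0..1}. df 0 x \<le> beta_max df \<and> df 2 x \<le> beta_max df) \<and>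
     (\<exists>\<delta>>0. \<delta> \<le> 1 \<and>
       (let H = {0..\<delta>};
            H' = {x\<in>{0..1}. f 1 x \<in> H};
            l\<^sub>0 = df 0 1;
            \<beta>' = Sup (df 0 ` ({0..1} - H) \<union> df 2 ` ({0..1} - H));
            \<beta>\<^sub>H = Inf (df 0 ` H \<union> df 2 ` H);
            l' = Sup (df 0 ` H')
        in f 1 ` H \<inter> H = {} \<and> f 1 ` H' \<inter> H' = {} \<and>
           f 1 ` {0..1} \<inter> H' = {} \<and> f 2 ` {0..1} \<inter> H' = {} \<and>
           \<beta>' < beta_min df \<and> 1 < \<beta>\<^sub>H \<and> \<beta>\<^sub>H < beta_min df \<and> l' < 1 \<and>
           \<bar>ln l\<^sub>0\<bar> * (ln (beta_max df) / ln \<beta>\<^sub>H) - \<bar>ln l'\<bar> + 2 / 3 * ln (beta_max df)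
             < 3 / 4 * ln \<beta>' \<and>
           (\<exists>L::real. L \<ge> 1 \<and>
              L > 4 * (\<bar>ln l\<^sub>0\<bar> * ln (beta_max df) / (ln \<beta>\<^sub>H * ln \<beta>')) \<and>
              ln (beta_max df powr L * \<gamma>) / (L + 1) < ln \<beta>')))"

end

theory Submission
  imports Defs "HOL-Real_Asymp.Real_Asymp"
begin

text \<open>Words of \<open>F\<close>-orbits in the base together with polynomially many labels in the fibre determine
  an orbit segment up to \<open>\<epsilon>\<close>, since the fibre maps are monotone interval maps.  Hence the fibres
  carry no entropy: the topological entropy is \<open>ln 3\<close>, and an invariant measure has maximal
  entropy iff its coding is uniform, that is, iff it projects to the Bernoulli measure
  \<open>(1/3, 1/3, 1/3)\<close>.  As \<open>\<gamma> (\<beta>\<^sub>0\<^sub>2\<^sup>+)\<^sup>2 < 1\<close>, the fibre maps contract on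
  average for this measure, so that over almost every base point only one point of the fibre has
  a complete orbit.  The measure is therefore the lift of the Bernoulli measure to the graph of
  these points, and the same average bounds its central exponent.\<close>

section \<open>Shannon entropy of finitely valued random variables\<close>

text \<open>The numerical hypothesis is a product over one symbol of each kind: \<open>f 0\<close>
  and \<open>f 2\<close> stretch by at most \<open>beta_max df\<close> and \<open>f 1\<close>
  shrinks by \<open>\<gamma>\<close>, so equal weights give the logarithmic mean
  \<open>ln (\<gamma> * (beta_max df)\<^sup>2) / 3\<close>. Single maps may expand, so two points
  over one base point are compared through the past: both are \<open>n\<close>-th images over a
  common base point, and the product of the bounds along the last \<open>n\<close> symbols controls
  their distance. The obstacle on the entropy side is that metric entropy is a supremum over all
  finite measurable partitions, whose cells need not have any topological regularity; closeness of
  orbits then does not fix the itinerary. Compact cores of the cells, together with a variable of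
  small entropy that records the exceptions, repair this. The resulting bound by
  \<open>block_entropy m / m\<close> holds for each fixed \<open>m\<close>, not only in the limit,
  and this turns maximal entropy into exact equidistribution of all words.\<close>

definition shannon :: "'a measure \<Rightarrow> ('a \<Rightarrow> 'b) \<Rightarrow> real" where
  "shannon M X = - (\<Sum>v\<in>X ` space M. measure M (X -` {v} \<inter> space M) * ln (measure M (X -` {v} \<inter> space M)))"

lemma shannon_cong:
  assumes "\<And>x. x \<in> space M \<Longrightarrow> X x = Y x"
  shows "shannon M X = shannon M Y"
proof -
  have "X ` space M = Y ` space M" using assms by (auto simp: image_iff)
  moreover have "X -` {v} \<inter> space M = Y -` {v} \<inter> space M" for v using assms by auto
  ultimately show ?thesis by (simp add: shannon_def)
qed

text \<open>A common finite index set makes the sums of two variables comparable; a value that is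
  not attained contributes \<open>0 * ln 0 = 0\<close>.\<close>

lemma shannon_superset:
  assumes "finite A" "X ` space M \<subseteq> A"
  shows "shannon M X = - (\<Sum>v\<in>A. measure M (X -` {v} \<inter> space M) * ln (measure M (X -` {v} \<inter> space M)))"
proof -
  have "measure M (X -` {v} \<inter> space M) = 0" if "v \<in> A - X ` space M" for v
  proof -
    have "X -` {v} \<inter> space M = {}" using that by auto
    then show ?thesis by simp
  qed
  then show ?thesis unfolding shannon_def
    by (subst sum.mono_neutral_left[OF assms]) auto
qed

context prob_space
begin

text \<open>Base \<open>exp 1\<close> makes the logarithm natural, so that data processing and the
  chain rule become available for \<open>shannon\<close>.\<close>

lemma shannon_eq_entropy:
  assumes "simple_function M X"
  shows "shannon M X = entropy (exp 1) (count_space (X ` space M)) X"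
proof -
  interpret information_space M "exp 1" by unfold_locales simp
  show ?thesis
    using entropy_simple_distributed[OF simple_distributedI[OF assms measure_nonneg refl]]
    by (simp add: shannon_def log_def)
qed

lemma shannon_le_compose:
  assumes X: "simple_function M X" and "\<And>x. x \<in> space M \<Longrightarrow> Y x = g (X x)"
  shows "shannon M Y \<le> shannon M X"
proof -
  interpret information_space M "exp 1" by unfold_locales simp
  have "shannon M Y = shannon M (g \<circ> X)" using assms(2) by (intro shannon_cong) simp
  also have "\<dots> = entropy (exp 1) (count_space ((g \<circ> X) ` space M)) (g \<circ> X)"
    by (rule shannon_eq_entropy[OF simple_function_compose[OF X]])
  also have "\<dots> \<le> shannon M X"
    unfolding shannon_eq_entropy[OF X] by (rule entropy_data_processing[OF X])
  finally show ?thesis .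
qed

lemma shannon_pair_le:
  assumes X: "simple_function M X" and Y: "simple_function M Y"
  shows "shannon M (\<lambda>x. (X x, Y x)) \<le> shannon M X + shannon M Y"
proof -
  interpret information_space M "exp 1" by unfold_locales simp
  show ?thesis
    unfolding shannon_eq_entropy[OF X] shannon_eq_entropy[OF Y] shannon_eq_entropy[OF simple_function_Pair[OF X Y]]
    using entropy_chain_rule[OF X Y] conditional_entropy_less_eq_entropy[OF Y X] by simp
qed

lemma shannon_le_ln_card:
  assumes X: "simple_function M X" and A: "finite A" "X ` space M \<subseteq> A"
  shows "shannon M X \<le> ln (card A)"
proof -
  interpret information_space M "exp 1" by unfold_locales simp
  have "X ` space M \<noteq> {}" using not_empty by auto
  then have pos: "card (X ` space M) > 0" using A finite_subset by (fastforce simp: card_gt_0_iff)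
  have "shannon M X \<le> ln (card (X ` space M))"
    unfolding shannon_eq_entropy[OF X]
    using entropy_le_card[OF simple_distributedI[OF X measure_nonneg refl]] by (simp add: log_def)
  also have "\<dots> \<le> ln (card A)" using card_mono[OF A] pos by simp
  finally show ?thesis .
qed

text \<open>With \<open>N = card A\<close>, the defect \<open>ln N - shannon M X\<close> is the sum
  over \<open>A\<close> of the gaps \<open>1 / N - p v + p v * ln (N * p v)\<close>. Each gap is
  nonnegative and vanishes only at \<open>p v = 1 / N\<close>, so zero defect forces the uniform
  law.\<close>

lemma shannon_max_imp_uniform:
  assumes X: "simple_function M X" and A: "finite A" "X ` space M \<subseteq> A"
    and max: "shannon M X = ln (card A)" and v: "v \<in> A"
  shows "prob (X -` {v} \<inter> space M) = 1 / card A"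
proof -
  define p where "p v = prob (X -` {v} \<inter> space M)" for v
  define N where "N = real (card A)"
  have N: "N > 0" using v A by (auto simp: N_def card_gt_0_iff)
  have sump: "(\<Sum>v\<in>A. p v) = 1"
  proof -
    have "(\<Sum>v\<in>A. p v) = prob (\<Union>v\<in>A. X -` {v} \<inter> space M)"
      unfolding p_def using A simple_functionD(2)[OF X]
      by (intro finite_measure_finite_Union[symmetric]) (auto simp: disjoint_family_on_def)
    also have "(\<Union>v\<in>A. X -` {v} \<inter> space M) = space M" using A by auto
    finally show ?thesis by (simp add: prob_space)
  qed
  have gap: "0 \<le> 1 / N - p v + p v * ln (N * p v)"
    and gap0: "1 / N - p v + p v * ln (N * p v) = 0 \<Longrightarrow> p v = 1 / N" for v
  proof -
    have p0: "p v \<ge> 0" by (simp add: p_def)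
    consider "p v = 0" | "p v > 0" using p0 by linarith
    then have *: "0 \<le> 1 / N - p v + p v * ln (N * p v) \<and>
      (1 / N - p v + p v * ln (N * p v) = 0 \<longrightarrow> p v = 1 / N)"
    proof cases
      case 1 then show ?thesis using N by simp
    next
      case 2
      \<comment> \<open>The ratio of the uniform weight to \<open>p v\<close> turns the gap into
        \<open>p v * (t - 1 - ln t)\<close>, where \<open>ln t \<le> t - 1\<close> has equality only
        at 1.\<close>
      define t where "t = 1 / (N * p v)"
      have t: "t > 0" using 2 N by (simp add: t_def)
      have eq: "1 / N - p v + p v * ln (N * p v) = p v * (t - 1 - ln t)"
        using 2 N by (simp add: t_def ln_div ln_mult field_simps)
      have "ln t \<le> t - 1" using t by (rule ln_le_minus_one)
      moreover have "p v = 1 / N" if "t - 1 - ln t = 0"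
      proof -
        have "t = 1" using ln_eq_minus_one[OF t] that by simp
        then show ?thesis using 2 N by (simp add: t_def field_simps)
      qed
      ultimately show ?thesis unfolding eq using 2 by auto
    qed
    show "0 \<le> 1 / N - p v + p v * ln (N * p v)"
      "1 / N - p v + p v * ln (N * p v) = 0 \<Longrightarrow> p v = 1 / N" using * by auto
  qed
  have "(\<Sum>v\<in>A. 1 / N - p v + p v * ln (N * p v)) = (\<Sum>v\<in>A. 1 / N - p v + p v * ln N + p v * ln (p v))"
  proof (rule sum.cong[OF refl])
    fix v
    show "1 / N - p v + p v * ln (N * p v) = 1 / N - p v + p v * ln N + p v * ln (p v)"
      using N by (cases "p v = 0") (auto simp: ln_mult algebra_simps p_def zero_less_measure_iff)
  qed
  also have "\<dots> = 1 - 1 + ln N - shannon M X"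
    using sump N unfolding shannon_superset[OF A] p_def[symmetric]
    by (simp add: sum.distrib sum_subtractf sum_distrib_right[symmetric] N_def[symmetric])
  also have "\<dots> = 0" using max by (simp add: N_def)
  finally have "\<forall>v\<in>A. 1 / N - p v + p v * ln (N * p v) = 0"
    using gap A by (subst (asm) sum_nonneg_eq_0_iff) auto
  then show ?thesis using gap0 v by (auto simp: p_def N_def)
qed

lemma shannon_distr_eq:
  assumes X: "simple_function M X" and Y: "simple_function M Y"
    and "\<And>v. prob (X -` {v} \<inter> space M) = prob (Y -` {v} \<inter> space M)"
  shows "shannon M X = shannon M Y"
proof -
  have "finite (X ` space M \<union> Y ` space M)" using X Y by (auto dest: simple_functionD)
  then show ?thesis using assms(3)
    by (subst (1 2) shannon_superset[of "X ` space M \<union> Y ` space M"]) auto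
qed

text \<open>Subadditivity, iterated. Simplicity is part of the conclusion because the inductive step
  for the entropy needs it for the shorter list.\<close>

lemma shannon_list_le:
  assumes "\<And>i. i < n \<Longrightarrow> simple_function M (X i)" "\<And>i. i < n \<Longrightarrow> shannon M (X i) \<le> c"
  shows "simple_function M (\<lambda>x. map (\<lambda>i. X i x) [0..<n]) \<and> shannon M (\<lambda>x. map (\<lambda>i. X i x) [0..<n]) \<le> n * c"
  using assms
proof (induction n)
  case 0
  have "shannon M (\<lambda>x. []::'b list) \<le> ln (card {[]::'b list})"
    by (rule shannon_le_ln_card) auto
  then show ?case by simp
next
  case (Suc n)
  let ?L = "\<lambda>x. map (\<lambda>i. X i x) [0..<n]"
  have IH: "simple_function M ?L" "shannon M ?L \<le> n * c" using Suc by auto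
  have Xn: "simple_function M (X n)" "shannon M (X n) \<le> c" using Suc.prems by auto
  note pair = simple_function_Pair[OF IH(1) Xn(1)]
  have eq: "(\<lambda>x. map (\<lambda>i. X i x) [0..<Suc n]) = (\<lambda>(l, y). l @ [y]) \<circ> (\<lambda>x. (?L x, X n x))"
    by auto
  have "simple_function M (\<lambda>x. map (\<lambda>i. X i x) [0..<Suc n])"
    unfolding eq by (rule simple_function_compose[OF pair])
  moreover have "shannon M (\<lambda>x. map (\<lambda>i. X i x) [0..<Suc n]) \<le> shannon M (\<lambda>x. (?L x, X n x))"
    by (rule shannon_le_compose[OF pair, where g="\<lambda>(l, y). l @ [y]"]) simp
  ultimately show ?case using shannon_pair_le[OF IH(1) Xn(1)] IH(2) Xn(2)
    by (simp add: algebra_simps)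
qed

text \<open>The dominant value \<open>a\<close> contributes at most \<open>1 - p a \<le> e\<close>,
  every other value at most \<open>2 * sqrt (p v) \<le> 2 * sqrt e\<close>. Both estimates of
  \<open>- (p v * ln (p v))\<close> come from \<open>ln x \<le> x - 1\<close>, at
  \<open>x = 1 / p v\<close> and at \<open>x = 1 / sqrt (p v)\<close>. For a fixed number of values
  the bound tends to 0 with \<open>e\<close>.\<close>

lemma shannon_concentrated:
  assumes X: "simple_function M X" and A: "finite A" "X ` space M \<subseteq> A"
    and a: "prob {x \<in> space M. X x \<noteq> a} \<le> e"
  shows "shannon M X \<le> e + 2 * real (card A) * sqrt e"
proof -
  define p where "p v = prob (X -` {v} \<inter> space M)" for v
  have sX: "X -` {v} \<inter> space M \<in> events" for v using simple_functionD(2)[OF X] by simp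
  have e0: "e \<ge> 0" using a measure_nonneg[of M] order_trans by blast
  have p01: "0 \<le> p v" "p v \<le> 1" for v by (auto simp: p_def)
  have bound1: "- (p v * ln (p v)) \<le> 1 - p v" for v
  proof (cases "p v = 0")
    case False
    then have pos: "p v > 0" using p01[of v] by simp
    then have "ln (1 / p v) \<le> 1 / p v - 1" by (intro ln_le_minus_one) simp
    then have "p v * ln (1 / p v) \<le> p v * (1 / p v - 1)" using pos by (intro mult_left_mono) auto
    then show ?thesis using pos by (simp add: ln_div algebra_simps)
  qed simp
  have bound2: "- (p v * ln (p v)) \<le> 2 * sqrt (p v)" for v
  proof (cases "p v = 0")
    case False
    then have pos: "p v > 0" using p01[of v] by simp
    have "ln (1 / sqrt (p v)) \<le> 1 / sqrt (p v) - 1" using pos by (intro ln_le_minus_one) simp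
    then have "- ln (p v) / 2 \<le> 1 / sqrt (p v)" using pos by (simp add: ln_div ln_sqrt)
    then have "p v * (- ln (p v) / 2) \<le> p v * (1 / sqrt (p v))" using pos by (intro mult_left_mono) auto
    also have "\<dots> = sqrt (p v)" using pos by (simp add: real_div_sqrt)
    finally show ?thesis by simp
  qed simp
  have pa: "1 - p a \<le> e"
  proof -
    have "prob {x \<in> space M. X x \<noteq> a} = prob (space M - X -` {a} \<inter> space M)"
      by (rule arg_cong[where f=prob]) auto
    then show ?thesis using a prob_compl[OF sX[of a]] by (simp add: p_def)
  qed
  have pv: "p v \<le> e" if "v \<noteq> a" for v
  proof -
    have "{x \<in> space M. X x \<noteq> a} = space M - X -` {a} \<inter> space M" by auto
    then have ev: "{x \<in> space M. X x \<noteq> a} \<in> events" using sX[of a] by auto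
    have "p v \<le> prob {x \<in> space M. X x \<noteq> a}"
      unfolding p_def using that ev by (intro finite_measure_mono) auto
    then show ?thesis using a by simp
  qed
  have "shannon M X \<le> (\<Sum>v\<in>A. - (p v * ln (p v)))"
    by (simp add: shannon_superset[OF A] p_def sum_negf)
  also have "\<dots> \<le> (\<Sum>v\<in>A. (if v = a then e else 0) + 2 * sqrt e)"
  proof (rule sum_mono)
    fix v
    show "- (p v * ln (p v)) \<le> (if v = a then e else 0) + 2 * sqrt e"
    proof (cases "v = a")
      case True
      have "0 \<le> 2 * sqrt e" using e0 by simp
      then have "1 - p a \<le> e + 2 * sqrt e" using pa by linarith
      then show ?thesis using bound1[of a] unfolding True if_P[OF refl] by (rule order_trans[rotated])
    next
      case False
      have "sqrt (p v) \<le> sqrt e" using pv[OF False] by simp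
      then have "- (p v * ln (p v)) \<le> 2 * sqrt e" using bound2[of v] by linarith
      then show ?thesis using False by simp
    qed
  qed
  also have "\<dots> \<le> e + 2 * real (card A) * sqrt e"
    using e0 A by (simp add: sum.distrib)
  finally show ?thesis .
qed

end


section \<open>Extensions of the full shift with subexponential fibre complexity\<close>

definition word :: "(int \<Rightarrow> nat) \<Rightarrow> int \<Rightarrow> nat \<Rightarrow> nat list" where
  "word \<omega> a n = map (\<lambda>j. \<omega> (a + int j)) [0..<n]"

definition words :: "nat \<Rightarrow> nat list set" where
  "words n = {v. set v \<subseteq> {..<3} \<and> length v = n}"

lemma finite_words [simp]: "finite (words n)"
  unfolding words_def by (rule finite_lists_length_eq) simp

lemma card_words [simp]: "card (words n) = 3 ^ n"
  unfolding words_def by (subst card_lists_length_eq) auto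

lemma word_in_words: "\<omega> \<in> full_shift_space \<Longrightarrow> word \<omega> a n \<in> words n"
  by (auto simp: word_def words_def full_shift_space_def)

lemma word_eq_iff:
  "word \<omega> a n = word \<omega>' a n \<longleftrightarrow> (\<forall>j\<in>{a..<a + int n}. \<omega> j = \<omega>' j)"
proof
  assume L: "word \<omega> a n = word \<omega>' a n"
  show "\<forall>j\<in>{a..<a + int n}. \<omega> j = \<omega>' j"
  proof
    fix j assume j: "j \<in> {a..<a + int n}"
    then have "nat (j - a) < n" by auto
    then have "word \<omega> a n ! nat (j - a) = \<omega> j" "word \<omega>' a n ! nat (j - a) = \<omega>' j"
      using j by (simp_all add: word_def)
    then show "\<omega> j = \<omega>' j" using L by simp
  qed
qed (auto simp: word_def)

lemma word_eq_list_iff: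
  "word \<omega> a n = v \<longleftrightarrow> length v = n \<and> (\<forall>i<n. \<omega> (a + int i) = v ! i)"
  unfolding word_def list_eq_iff_nth_eq by simp metis

lemma word_append: "word \<omega> a (m + n) = word \<omega> a m @ word \<omega> (a + int m) n"
  by (rule nth_equalityI) (auto simp: word_def nth_append ac_simps)

lemma word_shift: "word (shift \<omega>) a n = word \<omega> (a + 1) n"
  by (simp add: word_def shift_def ac_simps)

lemma words_eq_image: "v \<in> words n \<Longrightarrow> \<exists>\<omega>\<in>full_shift_space. word \<omega> a n = v"
proof (rule bexI)
  assume v: "v \<in> words n"
  \<comment> \<open>Left of \<open>a\<close> the truncation \<open>nat (j - a) = 0\<close> repeats
    the first letter of a nonempty \<open>v\<close>; right of the window the symbol is 0. Both are
    legal symbols.\<close>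
  let ?\<omega> = "\<lambda>j. if nat (j - a) < n then v ! nat (j - a) else 0"
  show "word ?\<omega> a n = v" using v by (intro nth_equalityI) (auto simp: word_def words_def)
  show "?\<omega> \<in> full_shift_space"
    using v nth_mem by (force simp: words_def full_shift_space_def)
qed

text \<open>Division by \<open>n\<close> removes the overhang \<open>a\<close> of the window, the
  constants and the logarithm of a linear number of labels.\<close>

lemma growth_limit:
  fixes c a b :: real
  shows "(\<lambda>n. ((real n + a) * c + b + ln (real n + 1)) / real n) \<longlonglongrightarrow> c"
  by real_asymp

text \<open>\<open>cells\<close> is zero fibre entropy in combinatorial form: \<open>N\<close> is
  independent of \<open>n\<close>, so the number of labels grows linearly. The window overhangs the
  orbit segment by \<open>k\<close> on both sides since closeness in a two-sided shift needs symbols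
  of the past and of the future. The class \<open>polish_space\<close> supplies inner regularity of
  measures.\<close>

locale shift_extension =
  fixes T :: "'a::{heine_borel,polish_space} \<Rightarrow> 'a" and K :: "'a set" and w :: "'a \<Rightarrow> int \<Rightarrow> nat"
  assumes compact_K: "compact K"
    and T_into: "p \<in> K \<Longrightarrow> T p \<in> K"
    and w_into: "p \<in> K \<Longrightarrow> w p \<in> full_shift_space"
    and w_T: "p \<in> K \<Longrightarrow> w (T p) = shift (w p)"
    and continuous_w: "continuous_on K (\<lambda>p. w p j)"
    and w_onto: "full_shift_space \<subseteq> w ` K"
    and cells: "e > 0 \<Longrightarrow> \<exists>k N S. \<forall>n. (\<forall>p\<in>K. S n p \<le> n * N) \<and>
      S n \<in> measurable (restrict_space borel K) (count_space UNIV) \<and>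
      (\<forall>p\<in>K. \<forall>q\<in>K. word (w p) (- int k) (n + 2 * k) = word (w q) (- int k) (n + 2 * k) \<and>
         S n p = (S n q :: nat) \<longrightarrow> (\<forall>i<n. dist ((T ^^ i) p) ((T ^^ i) q) < e))"
begin

lemma iterate_into: "p \<in> K \<Longrightarrow> (T ^^ i) p \<in> K"
  by (induction i) (auto intro: T_into)

lemma w_iterate: "p \<in> K \<Longrightarrow> w ((T ^^ i) p) j = w p (j + int i)"
  by (induction i arbitrary: j) (auto simp: w_T iterate_into shift_def ac_simps)

lemma word_iterate: "p \<in> K \<Longrightarrow> word (w ((T ^^ i) p)) a n = word (w p) (a + int i) n"
  by (simp add: word_def w_iterate ac_simps)

abbreviation spanning :: "nat \<Rightarrow> real \<Rightarrow> 'a set \<Rightarrow> bool" where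
  "spanning n e E \<equiv> E \<subseteq> K \<and> finite E \<and>
     (\<forall>x\<in>K. \<exists>y\<in>E. \<forall>i<n. dist ((T ^^ i) x) ((T ^^ i) y) < e)"

text \<open>Points with the same word and the same label stay \<open>e\<close>-close, so one
  representative of each attained pair spans; the bound counts the pairs.\<close>

lemma spanning_bound:
  assumes "e > 0"
  shows "\<exists>k N. \<forall>n. \<exists>E. spanning n e E \<and> card E \<le> 3 ^ (n + 2 * k) * (n * N + 1)"
proof -
  obtain k N and S :: "nat \<Rightarrow> 'a \<Rightarrow> nat" where S:
    "\<And>n p. p \<in> K \<Longrightarrow> S n p \<le> n * N"
    "\<And>n p q i. \<lbrakk>p \<in> K; q \<in> K; word (w p) (- int k) (n + 2 * k) = word (w q) (- int k) (n + 2 * k);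
         S n p = S n q; i < n\<rbrakk> \<Longrightarrow> dist ((T ^^ i) p) ((T ^^ i) q) < e"
    using cells[OF assms] by metis
  have "\<exists>E. spanning n e E \<and> card E \<le> 3 ^ (n + 2 * k) * (n * N + 1)" for n
  proof -
    define Z where "Z p = (word (w p) (- int k) (n + 2 * k), S n p)" for p
    have ZK: "Z ` K \<subseteq> words (n + 2 * k) \<times> {..n * N}"
      using S(1) by (auto simp: Z_def intro!: word_in_words w_into)
    then have fin: "finite (Z ` K)" by (rule finite_subset) simp
    have "card (Z ` K) \<le> card (words (n + 2 * k) \<times> {..n * N})"
      by (rule card_mono[OF _ ZK]) simp
    also have "\<dots> = 3 ^ (n + 2 * k) * (n * N + 1)" by (simp add: card_cartesian_product)
    finally have card: "card (Z ` K) \<le> 3 ^ (n + 2 * k) * (n * N + 1)" .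
    define E where "E = inv_into K Z ` Z ` K"
    have "spanning n e E"
    proof (intro conjI ballI)
      show "E \<subseteq> K" by (auto simp: E_def intro: inv_into_into)
      show "finite E" using fin by (simp add: E_def)
      fix x assume x: "x \<in> K"
      let ?y = "inv_into K Z (Z x)"
      have "?y \<in> K" "Z ?y = Z x" using x by (auto intro: inv_into_into f_inv_into_f)
      then show "\<exists>y\<in>E. \<forall>i<n. dist ((T ^^ i) x) ((T ^^ i) y) < e"
        using x by (intro bexI[of _ ?y]) (auto simp: Z_def E_def intro!: S(2))
    qed
    moreover have "card E \<le> card (Z ` K)" unfolding E_def by (rule card_image_le[OF fin])
    ultimately show ?thesis using card by (intro exI[of _ E]) simp
  qed
  then show ?thesis by blast
qed

text \<open>A continuous integer-valued function on a compact set is uniformly continuous, and a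
  tolerance of 1 means equality. At this scale, orbits that stay close have the same word.\<close>

lemma symbol_uniform: "\<exists>e>0. \<forall>p\<in>K. \<forall>q\<in>K. dist p q < e \<longrightarrow> w p 0 = w q 0"
proof -
  have "continuous_on K (\<lambda>p. real (w p 0))"
    by (rule continuous_on_compose2[OF _ continuous_w, of UNIV]) auto
  then have "uniformly_continuous_on K (\<lambda>p. real (w p 0))"
    by (rule compact_uniformly_continuous[OF _ compact_K])
  then obtain d where d: "d > 0" "\<forall>p\<in>K. \<forall>q\<in>K. dist q p < d \<longrightarrow> dist (real (w q 0)) (real (w p 0)) < 1"
    unfolding uniformly_continuous_on_def by (metis zero_less_one)
  have "w p 0 = w q 0" if "p \<in> K" "q \<in> K" "dist p q < d" for p q
    using d(2) that by (force simp: dist_real_def)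
  then show ?thesis using d(1) by blast
qed

text \<open>From above, \<open>spanning_bound\<close> at every scale. From below, at the scale of
  \<open>symbol_uniform\<close> a spanning set must show every one of the \<open>3 ^ n\<close>
  words, all of which occur because \<open>w\<close> is onto.\<close>

theorem topological_entropy_eq: "topological_entropy T K = ereal (ln 3)"
proof (rule antisym)
  show "topological_entropy T K \<le> ereal (ln 3)"
    unfolding topological_entropy_def
  proof (rule SUP_least)
    fix e :: real assume "e \<in> {0<..}"
    then have "e > 0" by simp
    from spanning_bound[OF this] obtain k N
      where kN: "\<forall>n. \<exists>E. spanning n e E \<and> card E \<le> 3 ^ (n + 2 * k) * (n * N + 1)"
      by (elim exE)
    have "ln (spanning_number T K n e) / n \<le> ((real n + 2 * k) * ln 3 + ln (real N + 1) + ln (real n + 1)) / n" for n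
    proof (rule divide_right_mono)
      let ?s = "spanning_number T K n e"
      obtain E where E: "spanning n e E" "card E \<le> 3 ^ (n + 2 * k) * (n * N + 1)"
        using kN by (elim allE[of _ n] exE conjE) (rule that, intro conjI)
      have "card E \<in> {card E |E. spanning n e E}" using E(1) by (intro CollectI exI[of _ E]) (rule conjI[OF refl])
      then have "?s \<le> card E" unfolding spanning_number_def
        by (rule cInf_lower) simp
      also have "card E \<le> 3 ^ (n + 2 * k) * ((N + 1) * (n + 1))"
        using E(2) by (rule order_trans) (intro mult_left_mono, auto)
      finally have "real ?s \<le> real (3 ^ (n + 2 * k) * ((N + 1) * (n + 1)))"
        by (rule of_nat_mono)
      then have le: "real ?s \<le> 3 ^ (n + 2 * k) * ((real N + 1) * (real n + 1))"
        by (simp only: of_nat_mult of_nat_power of_nat_numeral of_nat_add of_nat_1)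
      \<comment> \<open>If the spanning number is 0, the convention \<open>ln 0 = 0\<close> leaves
        only the nonnegativity of the right-hand side.\<close>
      show "ln ?s \<le> (real n + 2 * k) * ln 3 + ln (real N + 1) + ln (real n + 1)"
      proof (cases "?s = 0")
        case False
        then have "ln ?s \<le> ln (3 ^ (n + 2 * k) * ((real N + 1) * (real n + 1)))"
          using le by (intro ln_mono) auto
        also have "\<dots> = (real n + 2 * k) * ln 3 + ln (real N + 1) + ln (real n + 1)"
          by (subst ln_mult_pos, simp, simp, subst ln_mult_pos) (simp_all add: ln_realpow)
        finally show ?thesis .
      qed simp
    qed simp
    then have "limsup (\<lambda>n. ereal (ln (spanning_number T K n e) / n)) \<le>
      limsup (\<lambda>n. ereal (((real n + 2 * k) * ln 3 + ln (real N + 1) + ln (real n + 1)) / n))"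
      by (intro Limsup_mono always_eventually) simp
    also have "\<dots> = ereal (ln 3)"
      by (intro lim_imp_Limsup tendsto_ereal growth_limit) simp
    finally show "limsup (\<lambda>n. ereal (ln (spanning_number T K n e) / n)) \<le> ereal (ln 3)" .
  qed
  obtain e where e: "e > 0" "\<And>p q. p \<in> K \<Longrightarrow> q \<in> K \<Longrightarrow> dist p q < e \<Longrightarrow> w p 0 = w q 0"
    using symbol_uniform by blast
  have "ereal (ln 3) = limsup (\<lambda>n. ereal (ln 3))" by (simp add: Limsup_const)
  also have "\<dots> \<le> limsup (\<lambda>n. ereal (ln (spanning_number T K n e) / n))"
  proof (rule Limsup_mono, rule eventually_sequentiallyI[of 1])
    fix n :: nat assume n: "1 \<le> n"
    \<comment> \<open>Some finite spanning set exists, so the infimum in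
      \<open>spanning_number\<close> is over a nonempty set of naturals and is attained.\<close>
    obtain E\<^sub>0 where "spanning n e E\<^sub>0"
      using spanning_bound[OF e(1)] by (elim exE allE[of _ n] conjE) (rule that, intro conjI)
    then have "card E\<^sub>0 \<in> {card E |E. spanning n e E}"
      by (intro CollectI exI[of _ E\<^sub>0]) (rule conjI[OF refl])
    then have "{card E |E. spanning n e E} \<noteq> {}" by (intro notI) (simp only: empty_iff)
    then have "spanning_number T K n e \<in> {card E |E. spanning n e E}"
      unfolding spanning_number_def by (rule Inf_nat_def1)
    then obtain E where E: "spanning n e E" "spanning_number T K n e = card E"
      by (elim CollectE exE conjE) (rule that, intro conjI)
    have "words n \<subseteq> (\<lambda>p. word (w p) 0 n) ` E"
    proof
      fix v assume "v \<in> words n"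
      then obtain \<omega> where \<omega>: "\<omega> \<in> full_shift_space" "word \<omega> 0 n = v" using words_eq_image by blast
      then obtain p where p: "p \<in> K" "w p = \<omega>" using w_onto by auto
      then obtain y where y: "y \<in> E" "\<forall>i<n. dist ((T ^^ i) p) ((T ^^ i) y) < e" using E(1) by blast
      have yK: "y \<in> K" using y E(1) by blast
      have "w p (int i) = w y (int i)" if "i < n" for i
        using e(2)[OF iterate_into[OF p(1), of i] iterate_into[OF yK, of i]] y(2) that
        by (simp add: w_iterate p(1) yK)
      then have "word (w y) 0 n = v" using \<omega>(2) p(2) by (auto simp: word_def)
      then show "v \<in> (\<lambda>p. word (w p) 0 n) ` E" using y(1) by blast
    qed
    then have "card (words n) \<le> card ((\<lambda>p. word (w p) 0 n) ` E)"
      using E(1) by (intro card_mono) auto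
    also have "\<dots> \<le> card E" using E(1) by (intro card_image_le) auto
    finally have "3 ^ n \<le> spanning_number T K n e" using E(2) by simp
    then have "real (3 ^ n) \<le> spanning_number T K n e" by (rule of_nat_mono)
    then have "(3::real) ^ n \<le> spanning_number T K n e" by (simp only: of_nat_power of_nat_numeral)
    then have "ln ((3::real) ^ n) \<le> ln (spanning_number T K n e)"
      by (intro ln_mono) auto
    then show "ereal (ln 3) \<le> ereal (ln (spanning_number T K n e) / n)"
      using n by (simp add: ln_realpow field_simps)
  qed
  also have "\<dots> \<le> topological_entropy T K"
    unfolding topological_entropy_def using e(1) by (intro SUP_upper) auto
  finally show "ereal (ln 3) \<le> topological_entropy T K" .
qed

end


text \<open>The expression is the bound of \<open>shannon_concentrated\<close> for \<open>m\<close>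
  values; it is continuous in \<open>e\<close> and vanishes at 0.\<close>

lemma exists_small_concentration_bound:
  fixes c :: real
  assumes "c > 0"
  shows "\<exists>e>0. e + 2 * real m * sqrt e < c"
proof -
  have "((\<lambda>e. e + 2 * real m * sqrt e) \<longlongrightarrow> 0 + 2 * real m * sqrt 0) (at_right 0)"
    by (intro tendsto_intros)
  then have "eventually (\<lambda>e. e + 2 * real m * sqrt e < c) (at_right 0)"
    using assms by (intro order_tendstoD(2)) auto
  then have "eventually (\<lambda>e. e + 2 * real m * sqrt e < c \<and> e > 0) (at_right 0)"
    by (intro eventually_conj eventually_at_right_less) 
  then show ?thesis
    using eventually_happens'[OF trivial_limit_at_right_real] by blast
qed

section \<open>Block entropies of an invariant measure\<close>

locale shift_extension_measure = shift_extension T K w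
  for T :: "'a::{heine_borel,polish_space} \<Rightarrow> 'a" and K w +
  fixes M :: "'a measure"
  assumes inv: "invariant_borel_probability T K M"
begin

sublocale prob_space M
  using inv by (simp add: invariant_borel_probability_def)

lemma space_M: "space M = K"
  and sets_M: "sets M = sets (restrict_space borel K)"
  and measurable_T [measurable]: "T \<in> measurable M M"
  and distr_T: "distr M M T = M"
  using inv by (simp_all add: invariant_borel_probability_def)

lemma measurable_M: "measurable M N = measurable (restrict_space borel K) N"
  by (rule measurable_cong_sets[OF sets_M refl])

lemma measurable_iterate [measurable]: "T ^^ i \<in> measurable M M"
  by (induction i) (auto simp: comp_def id_def)

lemma measure_iterate:
  assumes "A \<in> sets M"
  shows "prob ((T ^^ i) -` A \<inter> space M) = prob A"
proof (induction i)
  case 0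
  then show ?case using sets.sets_into_space[OF assms] by (simp add: Int_absorb2)
next
  case (Suc i)
  let ?B = "(T ^^ i) -` A \<inter> space M"
  have B: "?B \<in> events" using assms by measurable
  have "(T ^^ Suc i) -` A \<inter> space M = T -` ?B \<inter> space M"
    using T_into by (auto simp: space_M funpow_swap1)
  also have "prob \<dots> = measure (distr M M T) ?B" by (rule measure_distr[symmetric, OF measurable_T B])
  finally show ?case using Suc by (simp only: distr_T)
qed

lemma measurable_w [measurable]: "(\<lambda>p. w p j) \<in> measurable M (count_space UNIV)"
proof -
  have "(\<lambda>p. w p j) \<in> borel_measurable (restrict_space borel K)"
    by (rule borel_measurable_continuous_on_restrict[OF continuous_w])
  then show ?thesis
    unfolding measurable_M using measurable_cong_sets[OF refl sets_borel_eq_count_space] by blast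
qed

lemma simple_word: "simple_function M (\<lambda>p. word (w p) a n)"
proof -
  have "(\<lambda>p. word (w p) a n) ` space M \<subseteq> words n"
    by (auto simp: space_M intro!: word_in_words w_into)
  then have "finite ((\<lambda>p. word (w p) a n) ` space M)" by (rule finite_subset) simp
  moreover have "(\<lambda>p. word (w p) a n) -` {v} \<inter> space M \<in> events" for v
  proof -
    have "(\<lambda>p. word (w p) a n) -` {v} \<inter> space M =
      (if length v = n then {p \<in> space M. \<forall>i<n. w p (a + int i) = v ! i} else {})"
      by (simp add: vimage_def Int_def word_eq_list_iff conj_ac)
    also have "\<dots> \<in> events" by auto
    finally show ?thesis .
  qed
  ultimately show ?thesis by (simp add: simple_function_def)
qed

lemma simple_iterate: "simple_function M X \<Longrightarrow> simple_function M (\<lambda>p. X ((T ^^ i) p))"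
  using simple_function_comp[OF measurable_iterate, of X i] by (simp add: comp_def)

lemma shannon_iterate:
  assumes X: "simple_function M X"
  shows "shannon M (\<lambda>p. X ((T ^^ i) p)) = shannon M X"
proof (rule shannon_distr_eq[OF simple_iterate[OF X] X])
  fix v
  have "(\<lambda>p. X ((T ^^ i) p)) -` {v} \<inter> space M = (T ^^ i) -` (X -` {v} \<inter> space M) \<inter> space M"
    using iterate_into by (auto simp: space_M)
  also have "prob \<dots> = prob (X -` {v} \<inter> space M)"
    by (rule measure_iterate[OF simple_functionD(2)[OF X]])
  finally show "prob ((\<lambda>p. X ((T ^^ i) p)) -` {v} \<inter> space M) = prob (X -` {v} \<inter> space M)" .
qed

definition block_entropy :: "nat \<Rightarrow> real" where
  "block_entropy n = shannon M (\<lambda>p. word (w p) 0 n)"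

lemma shannon_word: "shannon M (\<lambda>p. word (w p) a n) = block_entropy n"
proof -
  \<comment> \<open>Windows move only to the right under iteration of \<open>T\<close>; a negative
    \<open>a\<close> is therefore the start of the move and 0 its end.\<close>
  have pos: "shannon M (\<lambda>p. word (w p) (b + int i) n) = shannon M (\<lambda>p. word (w p) b n)" for b i
  proof -
    have "shannon M (\<lambda>p. word (w p) (b + int i) n) = shannon M (\<lambda>p. word (w ((T ^^ i) p)) b n)"
      by (rule shannon_cong) (simp add: space_M word_iterate)
    also have "\<dots> = shannon M (\<lambda>p. word (w p) b n)" by (rule shannon_iterate[OF simple_word])
    finally show ?thesis .
  qed
  show ?thesis
  proof (cases "a \<ge> 0")
    case True
    then show ?thesis using pos[of 0 "nat a"] by (simp add: block_entropy_def)
  next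
    case False
    then show ?thesis using pos[of a "nat (- a)"] by (simp add: block_entropy_def)
  qed
qed

lemma block_entropy_le: "block_entropy n \<le> n * ln 3"
proof -
  have "block_entropy n \<le> ln (card (words n))"
    unfolding block_entropy_def
    by (rule shannon_le_ln_card[OF simple_word finite_words]) (auto simp: space_M intro!: word_in_words w_into)
  then show ?thesis by (simp add: ln_realpow)
qed

lemma block_entropy_add: "block_entropy (m + n) \<le> block_entropy m + block_entropy n"
proof -
  have "block_entropy (m + n) \<le> shannon M (\<lambda>p. (word (w p) 0 m, word (w p) (0 + int m) n))"
    unfolding block_entropy_def
    by (rule shannon_le_compose[OF simple_function_Pair[OF simple_word simple_word], where g="\<lambda>(u, v). u @ v"])
      (simp add: word_append)
  also have "\<dots> \<le> block_entropy m + block_entropy n"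
    using shannon_pair_le[OF simple_word simple_word] by (simp only: shannon_word)
  finally show ?thesis .
qed

lemma block_entropy_mult: "block_entropy (q * m) \<le> q * block_entropy m"
proof (induction q)
  case 0
  then show ?case using block_entropy_le[of 0] by simp
next
  case (Suc q)
  then show ?case using block_entropy_add[of m "q * m"] by (simp add: algebra_simps)
qed

text \<open>Write \<open>n = q * m + r\<close> with \<open>r < m\<close>: the \<open>q\<close> full
  blocks cost \<open>block_entropy m\<close> each, and the remaining symbols cost at most
  \<open>m * ln 3\<close>. Every block length thus bounds the growth rate.\<close>

lemma block_entropy_le_linear:
  assumes "m > 0"
  shows "block_entropy n \<le> n * (block_entropy m / m) + m * ln 3"
proof -
  define q r where "q = n div m" and "r = n mod m"
  have n: "n = q * m + r" and r: "r < m" using assms by (auto simp: q_def r_def)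
  have neg: "prob A * ln (prob A) \<le> 0" for A
    by (cases "prob A = 0") (auto intro!: mult_nonneg_nonpos simp: zero_less_measure_iff)
  have nonneg: "block_entropy m \<ge> 0"
    unfolding block_entropy_def shannon_def sum_negf[symmetric]
    using neg by (intro sum_nonneg) auto
  have "block_entropy n \<le> block_entropy (q * m) + block_entropy r"
    unfolding n by (rule block_entropy_add)
  also have "\<dots> \<le> q * block_entropy m + r * ln 3"
    by (rule add_mono[OF block_entropy_mult block_entropy_le])
  also have "\<dots> \<le> n * (block_entropy m / m) + m * ln 3"
  proof (rule add_mono)
    have "real q * block_entropy m = real (q * m) * (block_entropy m / m)" using assms by simp
    also have "\<dots> \<le> n * (block_entropy m / m)"
      using nonneg n by (intro mult_right_mono) (auto simp only: of_nat_le_iff, auto)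
    finally show "real q * block_entropy m \<le> n * (block_entropy m / m)" .
  qed (use r in auto)
  finally show ?thesis .
qed

section \<open>Itineraries of measurable partitions\<close>

definition cell :: "'a set set \<Rightarrow> 'a \<Rightarrow> 'a set" where
  "cell P p = (THE A. A \<in> P \<and> p \<in> A)"

definition itinerary :: "'a set set \<Rightarrow> nat \<Rightarrow> 'a \<Rightarrow> 'a set list" where
  "itinerary P n p = map (\<lambda>i. cell P ((T ^^ i) p)) [0..<n]"

context
  fixes P assumes P: "finite_measurable_partition M P"
begin

lemma finite_P: "finite P" and P_sets: "A \<in> P \<Longrightarrow> A \<in> events" and P_partition: "partition_on K P"
  using P by (auto simp: finite_measurable_partition_def space_M)

lemma cell_eq: "A \<in> P \<Longrightarrow> p \<in> A \<Longrightarrow> cell P p = A"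
  unfolding cell_def using partition_onD2[OF P_partition]
  by (intro the_equality) (auto simp: disjoint_def)

lemma cell_in: assumes "p \<in> K" shows "cell P p \<in> P" "p \<in> cell P p"
proof -
  obtain A where "A \<in> P" "p \<in> A" using partition_onD1[OF P_partition] assms by auto
  then show "cell P p \<in> P" "p \<in> cell P p" using cell_eq by auto
qed

lemma simple_cell: "simple_function M (cell P)"
  unfolding simple_function_def
proof (intro conjI ballI)
  show "finite (cell P ` space M)"
    by (rule finite_subset[OF _ finite_P]) (auto simp: space_M intro: cell_in)
  fix A assume "A \<in> cell P ` space M"
  then have A: "A \<in> P" by (auto simp: space_M intro: cell_in)
  have "A \<subseteq> K" using sets.sets_into_space[OF P_sets[OF A]] by (simp add: space_M)
  then have "cell P -` {A} \<inter> space M = A"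
    using cell_eq[OF A] cell_in(2) unfolding space_M by (intro set_eqI iffI) (blast, simp, blast)
  then show "cell P -` {A} \<inter> space M \<in> events" using P_sets[OF A] by simp
qed

lemma simple_itinerary: "simple_function M (itinerary P n)"
  unfolding itinerary_def
  using shannon_list_le[of n "\<lambda>i p. cell P ((T ^^ i) p)" "shannon M (cell P)"]
  by (simp add: simple_iterate[OF simple_cell] shannon_iterate[OF simple_cell])

text \<open>The nonempty members of the join are exactly the fibres of the itinerary. The join may
  also contain the empty set, which contributes \<open>0 * ln 0 = 0\<close>.\<close>

lemma partition_entropy_join:
  "partition_entropy M (iterated_join M T P n) = shannon M (itinerary P n)"
proof -
  let ?X = "itinerary P n"
  let ?g = "\<lambda>v. ?X -` {v} \<inter> space M"
  let ?J = "iterated_join M T P n"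
  have J: "{x \<in> space M. \<forall>i<n. (T ^^ i) x \<in> A i} = ?g (map A [0..<n])" if "\<forall>i<n. A i \<in> P" for A
  proof (intro set_eqI iffI)
    fix x assume "x \<in> {x \<in> space M. \<forall>i<n. (T ^^ i) x \<in> A i}"
    then show "x \<in> ?g (map A [0..<n])" using that by (auto simp: itinerary_def cell_eq)
  next
    fix x assume x: "x \<in> ?g (map A [0..<n])"
    then have "(T ^^ i) x \<in> K" for i by (simp add: iterate_into space_M)
    then have "(T ^^ i) x \<in> A i" if "i < n" for i
      using x that cell_in(2)[of "(T ^^ i) x"] by (auto simp: itinerary_def)
    then show "x \<in> {x \<in> space M. \<forall>i<n. (T ^^ i) x \<in> A i}" using x by simp
  qed
  have sub: "?J \<subseteq> ?g ` {v. set v \<subseteq> P \<and> length v = n}"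
  proof
    fix B assume "B \<in> ?J"
    then obtain A where "\<forall>i<n. A i \<in> P" "B = {x \<in> space M. \<forall>i<n. (T ^^ i) x \<in> A i}"
      unfolding iterated_join_def by blast
    then show "B \<in> ?g ` {v. set v \<subseteq> P \<and> length v = n}"
      by (intro image_eqI[of _ _ "map A [0..<n]"]) (auto simp only: J, auto)
  qed
  have fin: "finite ?J"
    by (rule finite_subset[OF sub]) (intro finite_imageI finite_lists_length_eq finite_P)
  have eq: "?J - {{}} = ?g ` (?X ` space M)"
  proof (intro equalityI subsetI)
    fix B assume "B \<in> ?J - {{}}"
    then have B: "B \<in> ?g ` {v. set v \<subseteq> P \<and> length v = n}" "B \<noteq> {}" using sub by blast+
    from B(1) obtain v where v: "B = ?g v" by (rule imageE)
    with B(2) show "B \<in> ?g ` (?X ` space M)" by auto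
  next
    fix B assume "B \<in> ?g ` (?X ` space M)"
    then obtain x where x: "x \<in> space M" "B = ?g (?X x)" by auto
    have "\<forall>i<n. cell P ((T ^^ i) x) \<in> P" using x(1) by (auto simp: space_M intro!: cell_in iterate_into)
    then have "B \<in> ?J"
      unfolding x(2) iterated_join_def
      by (intro CollectI exI[of _ "\<lambda>i. cell P ((T ^^ i) x)"]) (simp add: J itinerary_def[of P n x])
    then show "B \<in> ?J - {{}}" using x by auto
  qed
  have "partition_entropy M ?J = - (\<Sum>A\<in>?J - {{}}. prob A * ln (prob A))"
    unfolding partition_entropy_def using fin
    by (intro arg_cong[where f=uminus] sum.mono_neutral_right) auto
  also have "\<dots> = shannon M ?X"
    unfolding eq shannon_def by (subst sum.reindex) (auto simp: inj_on_def)
  finally show ?thesis .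
qed

text \<open>Cells of a measurable partition may accumulate on each other. Compact subsets of almost
  full measure cannot, and closeness of two core points will decide their cell.\<close>

lemma exists_compact_cores:
  assumes "e > 0"
  shows "\<exists>C. (\<forall>A\<in>P. compact (C A) \<and> C A \<subseteq> A \<and> prob (A - C A) < e)"
proof -
  have K: "K \<in> sets borel" using compact_K by (rule borel_compact)
  have "id \<in> measurable (restrict_space borel K) borel"
    by (intro measurable_restrict_space1) simp
  then have id: "id \<in> borel_measurable M" unfolding measurable_M .
  \<comment> \<open>\<open>M\<close> lives on the subspace \<open>K\<close>; inner regularity is
    applied to its extension by zero to the whole space.\<close>
  define M' where "M' = distr M borel id"
  have M': "sets M' = sets borel" by (simp add: M'_def)
  interpret M': prob_space M' unfolding M'_def by (rule prob_space_distr[OF id])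
  have "\<exists>C. compact C \<and> C \<subseteq> A \<and> prob (A - C) < e" if A: "A \<in> P" for A
  proof -
    have "A \<in> sets (restrict_space borel K)" using P_sets[OF A] sets_M by simp
    then have AK: "A \<subseteq> K" "A \<in> sets borel" using K by (auto simp: sets_restrict_space_iff)
    have emeas: "emeasure M' B = emeasure M B" if "B \<in> sets borel" "B \<subseteq> K" for B
    proof -
      have "id -` B \<inter> space M = B" using that(2) by (auto simp: space_M)
      then show ?thesis unfolding M'_def by (simp add: emeasure_distr[OF id that(1)])
    qed
    have "emeasure M' A = (SUP C\<in>{C. C \<subseteq> A \<and> compact C}. emeasure M' C)"
      by (rule inner_regular[OF M' _ AK(2)]) simp
    moreover have "emeasure M' A \<noteq> \<infinity>" by simp
    ultimately have "\<exists>C\<in>{C. C \<subseteq> A \<and> compact C}. emeasure M' A < emeasure M' C + ennreal e"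
      using assms by (intro SUP_approx_ennreal) auto
    then obtain C where C: "C \<subseteq> A" "compact C" "emeasure M' A < emeasure M' C + ennreal e" by auto
    have Cb: "C \<in> sets borel" using C(2) by (rule borel_compact)
    have "C \<in> sets (restrict_space borel K)" using Cb C(1) AK(1) K by (auto simp: sets_restrict_space_iff)
    then have CM: "C \<in> events" using sets_M by simp
    have "emeasure M A < emeasure M C + ennreal e" using C AK emeas Cb by (metis subset_trans)
    then have "ennreal (prob A) < ennreal (prob C + e)"
      using assms by (simp add: emeasure_eq_measure ennreal_plus)
    then have "prob A < prob C + e" using assms by (subst (asm) ennreal_less_iff) auto
    then have "prob (A - C) < e" using finite_measure_Diff[OF P_sets[OF A] CM C(1)] by simp
    then show ?thesis using C by blast
  qed
  then show ?thesis by (intro bchoice) blast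
qed

lemma exists_separation:
  assumes "\<And>A. A \<in> P \<Longrightarrow> compact (C A)" "\<And>A. A \<in> P \<Longrightarrow> C A \<subseteq> A"
  shows "\<exists>d>0. \<forall>A\<in>P. \<forall>B\<in>P. \<forall>x\<in>C A. \<forall>y\<in>C B. dist x y < d \<longrightarrow> A = B"
proof -
  have "\<exists>d>0. \<forall>x\<in>C A. \<forall>y\<in>C B. A \<noteq> B \<longrightarrow> d \<le> dist x y" if "A \<in> P" "B \<in> P" for A B
  proof (cases "A = B")
    case False
    then have "A \<inter> B = {}" using disjointD[OF partition_onD2[OF P_partition] that] by simp
    then have "C A \<inter> C B = {}" using assms(2)[OF that(1)] assms(2)[OF that(2)] by blast
    then show ?thesis
      using separate_compact_closed[OF assms(1)[OF that(1)] compact_imp_closed[OF assms(1)[OF that(2)]]]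
      by blast
  qed (auto intro: exI[of _ 1])
  then obtain d where d: "\<And>A B. A \<in> P \<Longrightarrow> B \<in> P \<Longrightarrow> d A B > (0::real)"
    "\<And>A B x y. A \<in> P \<Longrightarrow> B \<in> P \<Longrightarrow> x \<in> C A \<Longrightarrow> y \<in> C B \<Longrightarrow> A \<noteq> B \<Longrightarrow> d A B \<le> dist x y"
    by metis
  \<comment> \<open>There are finitely many pairs of cells, so their least distance is positive; the
    inserted 1 keeps the set nonempty.\<close>
  define D where "D = Min (insert 1 ((\<lambda>(A, B). d A B) ` (P \<times> P)))"
  have fin: "finite (insert 1 ((\<lambda>(A, B). d A B) ` (P \<times> P)))" using finite_P by simp
  have "D > 0" unfolding D_def using fin d(1) by (subst Min_gr_iff) auto
  moreover have "D \<le> d A B" if "A \<in> P" "B \<in> P" for A B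
    unfolding D_def using fin that by (intro Min_le) auto
  ultimately show ?thesis using d(2) by (intro exI[of _ D]) (meson not_le order_trans)
qed

text \<open>On compact cores of the cells of \<open>P\<close> the itinerary is read off from a word and one of
  polynomially many labels; outside the cores the missing information is recorded by a copy of
  a variable with small entropy.\<close>

lemma itinerary_entropy_bound:
  fixes c :: real
  assumes "c > 0"
  shows "\<exists>k N. \<forall>n. shannon M (itinerary P n) \<le> block_entropy (n + 2 * k) + ln (real n * real N + 1) + n * c"
proof -
  \<comment> \<open>The error variable \<open>D\<close> below takes at most
    \<open>card P + 1\<close> values, which fixes the constant.\<close>
  obtain e where e: "e > 0" "e + 2 * real (card P + 1) * sqrt e < c"
    using exists_small_concentration_bound[OF assms] by blast
  have Pne: "card P > 0"
    using finite_P partition_onD1[OF P_partition] not_empty by (auto simp: card_gt_0_iff space_M)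
  \<comment> \<open>A share of \<open>e / card P\<close> for each cell keeps the probability of
    missing the cores below \<open>e\<close> in total.\<close>
  obtain C where C: "\<And>A. A \<in> P \<Longrightarrow> compact (C A)" "\<And>A. A \<in> P \<Longrightarrow> C A \<subseteq> A"
    "\<And>A. A \<in> P \<Longrightarrow> prob (A - C A) < e / card P"
    using exists_compact_cores[of "e / card P"] e(1) Pne by auto
  obtain d where d: "d > 0"
    "\<And>A B x y. A \<in> P \<Longrightarrow> B \<in> P \<Longrightarrow> x \<in> C A \<Longrightarrow> y \<in> C B \<Longrightarrow> dist x y < d \<Longrightarrow> A = B"
    using exists_separation[of C] C by metis
  obtain k N and S :: "nat \<Rightarrow> 'a \<Rightarrow> nat" where S:
    "\<And>n p. p \<in> K \<Longrightarrow> S n p \<le> n * N"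
    "\<And>n. S n \<in> measurable (restrict_space borel K) (count_space UNIV)"
    "\<And>n p q i. \<lbrakk>p \<in> K; q \<in> K; word (w p) (- int k) (n + 2 * k) = word (w q) (- int k) (n + 2 * k);
         S n p = S n q; i < n\<rbrakk> \<Longrightarrow> dist ((T ^^ i) p) ((T ^^ i) q) < d"
    using cells[OF d(1)] by metis
  have CM: "C A \<in> events" if "A \<in> P" for A
  proof -
    have "C A \<subseteq> K" using C(2)[OF that] sets.sets_into_space[OF P_sets[OF that]] by (auto simp: space_M)
    then have "C A \<in> sets (restrict_space borel K)"
      using borel_compact[OF C(1)[OF that]] borel_compact[OF compact_K] by (simp add: sets_restrict_space_iff)
    then show ?thesis using sets_M by simp
  qed
  \<comment> \<open>\<open>None\<close> is the likely value and says that the point lies in a core;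
    off the cores \<open>D\<close> gives the cell outright.\<close>
  define D where "D p = (if p \<in> C (cell P p) then None else Some (cell P p))" for p
  have D_vals: "D ` space M \<subseteq> insert None (Some ` P)"
    by (auto simp: D_def space_M intro: cell_in)
  have finD: "finite (insert None (Some ` P))" using finite_P by simp
  have off_core: "{x \<in> space M. D x \<noteq> None} = (\<Union>A\<in>P. A - C A)"
  proof (intro set_eqI iffI)
    fix x assume "x \<in> {x \<in> space M. D x \<noteq> None}"
    then have "x \<in> K" "x \<notin> C (cell P x)" by (auto simp: D_def space_M split: if_splits)
    then show "x \<in> (\<Union>A\<in>P. A - C A)" using cell_in by blast
  next
    fix x assume "x \<in> (\<Union>A\<in>P. A - C A)"
    then obtain A where A: "A \<in> P" "x \<in> A" "x \<notin> C A" by blast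
    then have "x \<in> space M" using sets.sets_into_space[OF P_sets] by blast
    then show "x \<in> {x \<in> space M. D x \<noteq> None}" using A by (simp add: D_def cell_eq)
  qed
  have simpleD: "simple_function M D"
    unfolding simple_function_def
  proof (intro conjI ballI)
    show "finite (D ` space M)" by (rule finite_subset[OF D_vals finD])
    fix v assume "v \<in> D ` space M"
    then have "v \<in> insert None (Some ` P)" by (rule subsetD[OF D_vals])
    then consider "v = None" | A where "A \<in> P" "v = Some A" by (elim insertE imageE)
    then show "D -` {v} \<inter> space M \<in> events"
    proof cases
      case 1
      have "D -` {v} \<inter> space M = space M - {x \<in> space M. D x \<noteq> None}" using 1 by auto
      moreover have "(\<Union>A\<in>P. A - C A) \<in> events"
        by (rule sets.finite_UN[OF finite_P]) (intro sets.Diff CM P_sets)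
      ultimately show ?thesis unfolding off_core by (simp only: sets.compl_sets)
    next
      case 2
      have "A \<subseteq> space M" using sets.sets_into_space[OF P_sets[OF 2(1)]] .
      moreover have "D x = v \<longleftrightarrow> x \<in> A - C A" if "x \<in> space M" for x
      proof (cases "x \<in> A")
        case True
        then have "cell P x = A" by (rule cell_eq[OF 2(1)])
        then show ?thesis using True by (simp add: D_def 2(2))
      next
        case False
        then have "cell P x \<noteq> A" using cell_in(2)[of x] that by (metis space_M)
        then show ?thesis using False by (simp add: D_def 2(2))
      qed
      ultimately have "D -` {v} \<inter> space M = A - C A" by blast
      then show ?thesis using CM P_sets 2(1) by auto
    qed
  qed
  have entD: "shannon M D \<le> c"
  proof -
    have "prob {x \<in> space M. D x \<noteq> None} \<le> (\<Sum>A\<in>P. prob (A - C A))"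
      unfolding off_core using CM P_sets by (intro finite_measure_subadditive_finite finite_P) auto
    also have "\<dots> \<le> (\<Sum>A\<in>P. e / card P)" using C(3) by (intro sum_mono less_imp_le)
    also have "\<dots> = e" using Pne by simp
    finally have "prob {x \<in> space M. D x \<noteq> None} \<le> e" .
    from shannon_concentrated[OF simpleD finD D_vals this]
    have "shannon M D \<le> e + 2 * real (card (insert None (Some ` P))) * sqrt e" .
    also have "card (insert None (Some ` P)) = card P + 1"
      using finite_P by (simp add: card_image image_iff)
    finally show ?thesis using e(2) by linarith
  qed
  have "shannon M (itinerary P n) \<le> block_entropy (n + 2 * k) + ln (real n * real N + 1) + n * c" for n
  proof -
    let ?W = "\<lambda>p. word (w p) (- int k) (n + 2 * k)"
    let ?Z = "\<lambda>p. (?W p, S n p)"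
    let ?D = "\<lambda>p. map (\<lambda>i. D ((T ^^ i) p)) [0..<n]"
    have SM: "S n \<in> measurable M (count_space UNIV)" using S(2) by (simp add: measurable_M)
    have Svals: "S n ` space M \<subseteq> {..n * N}" using S(1) by (auto simp: space_M)
    have simpleS: "simple_function M (S n)"
      unfolding simple_function_def using finite_subset[OF Svals] measurable_sets[OF SM] by auto
    have simpleZ: "simple_function M ?Z" by (rule simple_function_Pair[OF simple_word simpleS])
    have D_list: "simple_function M ?D" "shannon M ?D \<le> n * c"
      using shannon_list_le[of n "\<lambda>i p. D ((T ^^ i) p)" c] simple_iterate[OF simpleD]
        shannon_iterate[OF simpleD] entD by auto
    \<comment> \<open>Decoder for core points: any point with data \<open>z\<close> that is in a
      core at time \<open>i\<close> reveals the cell. Two such points are \<open>d\<close>-close at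
      that time, so the choice of the point does not matter.\<close>
    define g where "g z i = (SOME A. A \<in> P \<and> (\<exists>q\<in>K. ?Z q = z \<and> (T ^^ i) q \<in> C A))" for z i
    have g: "g (?Z p) i = cell P ((T ^^ i) p)" if p: "p \<in> K" "i < n" "D ((T ^^ i) p) = None" for p i
    proof -
      let ?A = "cell P ((T ^^ i) p)"
      have A: "?A \<in> P" "(T ^^ i) p \<in> C ?A"
        using p cell_in(1)[OF iterate_into[OF p(1)]] by (auto simp: D_def split: if_splits)
      show ?thesis
        unfolding g_def
      proof (rule some_equality)
        show "?A \<in> P \<and> (\<exists>q\<in>K. ?Z q = ?Z p \<and> (T ^^ i) q \<in> C ?A)" using A p(1) by blast
        fix B assume "B \<in> P \<and> (\<exists>q\<in>K. ?Z q = ?Z p \<and> (T ^^ i) q \<in> C B)"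
        then obtain q where q: "B \<in> P" "q \<in> K" "?Z q = ?Z p" "(T ^^ i) q \<in> C B" by blast
        have "dist ((T ^^ i) q) ((T ^^ i) p) < d" by (rule S(3)[of _ _ n]) (use q p in auto)
        then show "B = ?A" using d(2) q A by blast
      qed
    qed
    \<comment> \<open>At each time the cell is read from \<open>D\<close> if it is recorded there,
      and is otherwise decoded from word and label.\<close>
    have "shannon M (itinerary P n) \<le> shannon M (\<lambda>p. (?Z p, ?D p))"
    proof (rule shannon_le_compose[OF simple_function_Pair[OF simpleZ D_list(1)],
          where g="\<lambda>(z, l). map (\<lambda>i. case l ! i of None \<Rightarrow> g z i | Some A \<Rightarrow> A) [0..<n]"])
      fix p assume "p \<in> space M"
      then have "p \<in> K" by (simp add: space_M)
      then have "(case D ((T ^^ i) p) of None \<Rightarrow> g (?Z p) i | Some A \<Rightarrow> A) = cell P ((T ^^ i) p)"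
        if "i < n" for i
        using g[of p i] that by (auto simp: D_def split: if_splits)
      then show "itinerary P n p = (\<lambda>(z, l). map (\<lambda>i. case l ! i of None \<Rightarrow> g z i | Some A \<Rightarrow> A) [0..<n]) (?Z p, ?D p)"
        by (simp add: itinerary_def)
    qed
    also have "\<dots> \<le> shannon M ?Z + n * c"
      using shannon_pair_le[OF simpleZ D_list(1)] D_list(2) by linarith
    also have "shannon M ?Z \<le> block_entropy (n + 2 * k) + ln (real n * real N + 1)"
    proof -
      have "shannon M (S n) \<le> ln (real n * real N + 1)"
        using shannon_le_ln_card[OF simpleS _ Svals] by (simp add: add.commute)
      then show ?thesis
        using shannon_pair_le[OF simple_word simpleS, of "- int k" "n + 2 * k"] unfolding shannon_word
        by linarith
    qed
    finally show ?thesis by simp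
  qed
  then show ?thesis by blast
qed

end

text \<open>An itinerary costs no more than the block entropy of a slightly longer word, a
  logarithmic term and \<open>n * c\<close>, where \<open>c\<close> is arbitrary.
  \<open>block_entropy_le_linear\<close> replaces the growing word by blocks of the fixed length
  \<open>m\<close>.\<close>

lemma metric_entropy_le:
  assumes "m > 0"
  shows "metric_entropy M T \<le> ereal (block_entropy m / m)"
  unfolding metric_entropy_def
proof (rule SUP_least)
  fix P assume "P \<in> {P. finite_measurable_partition M P}"
  then have P: "finite_measurable_partition M P" by simp
  let ?h = "block_entropy m / m"
  let ?l = "limsup (\<lambda>n. ereal (partition_entropy M (iterated_join M T P n) / n))"
  have "?l \<le> ereal ?h + ereal c" if c: "c > 0" for c
  proof -
    obtain k N where kN: "\<And>n. shannon M (itinerary P n) \<le> block_entropy (n + 2 * k) + ln (real n * real N + 1) + n * c"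
      using itinerary_entropy_bound[OF P c] by blast
    let ?b = "m * ln 3 + ln (real N + 1)"
    have "partition_entropy M (iterated_join M T P n) / n \<le>
      ((real n + 2 * k) * ?h + ?b + ln (real n + 1)) / n + c" if "n \<ge> 1" for n
    proof -
      have "ln (real n * real N + 1) \<le> ln ((real N + 1) * (real n + 1))"
        by (intro ln_mono) (auto simp: algebra_simps intro!: add_pos_nonneg)
      also have "\<dots> = ln (real N + 1) + ln (real n + 1)" by (rule ln_mult_pos) auto
      finally have "shannon M (itinerary P n) \<le> (real n + 2 * k) * ?h + ?b + ln (real n + 1) + n * c"
        using kN[of n] block_entropy_le_linear[OF assms, of "n + 2 * k"] by simp
      then have "partition_entropy M (iterated_join M T P n) / n \<le>
        ((real n + 2 * k) * ?h + ?b + ln (real n + 1) + n * c) / n"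
        unfolding partition_entropy_join[OF P] by (rule divide_right_mono) simp
      also have "\<dots> = ((real n + 2 * k) * ?h + ?b + ln (real n + 1)) / n + c"
        using that by (simp add: add_divide_distrib)
      finally show ?thesis .
    qed
    then have "?l \<le> limsup (\<lambda>n. ereal (((real n + 2 * k) * ?h + ?b + ln (real n + 1)) / n + c))"
      by (intro Limsup_mono eventually_sequentiallyI[of 1]) simp
    also have "\<dots> = ereal (?h + c)"
      by (intro lim_imp_Limsup tendsto_ereal tendsto_add growth_limit tendsto_const) simp
    finally show ?thesis by simp
  qed
  then show "?l \<le> ereal ?h" using ereal_le_epsilon2 by blast
qed

text \<open>The partition by the zeroth symbol suffices, because the word of length \<open>n\<close>
  is a function of its itinerary. That no cell is empty, as a partition requires, follows from
  \<open>w\<close> being onto.\<close>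

lemma metric_entropy_ge: "limsup (\<lambda>n. ereal (block_entropy n / n)) \<le> metric_entropy M T"
proof -
  define A where "A i = {p \<in> K. w p 0 = i}" for i
  define P where "P = A ` {..<3}"
  have A_ne: "A i \<noteq> {}" if "i < 3" for i
  proof -
    have "(\<lambda>_. i) \<in> full_shift_space" using that by (simp add: full_shift_space_def)
    then obtain p where "p \<in> K" "w p = (\<lambda>_. i)" using w_onto by auto
    then show ?thesis by (auto simp: A_def)
  qed
  have A_M: "A i \<in> events" for i
  proof -
    have "A i = {p \<in> space M. w p 0 = i}" by (simp add: A_def space_M)
    also have "\<dots> \<in> events" by measurable
    finally show ?thesis .
  qed
  have "partition_on K P"
  proof (rule partition_onI)
    show "\<Union> P = K" using w_into by (auto simp: P_def A_def full_shift_space_def)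
    show "{} \<notin> P" using A_ne by (force simp: P_def)
    show "\<And>p q. p \<in> P \<Longrightarrow> q \<in> P \<Longrightarrow> p \<noteq> q \<Longrightarrow> disjnt p q"
      by (auto simp: P_def A_def disjnt_def)
  qed
  then have P: "finite_measurable_partition M P"
    using A_M by (auto simp: finite_measurable_partition_def space_M P_def)
  \<comment> \<open>The zeroth symbol is constant on a cell, so any representative of the cell shows
    it.\<close>
  define h where "h B = w (SOME p. p \<in> B) 0" for B
  have h: "h (cell P p) = w p 0" if "p \<in> K" for p
  proof -
    have c: "cell P p \<in> P" "p \<in> cell P p" using cell_in[OF P that] .
    then obtain i where i: "cell P p = A i" by (auto simp: P_def)
    have "(SOME p. p \<in> A i) \<in> A i" using c(2) i by (intro someI[of "\<lambda>p. p \<in> A i"]) simp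
    then show ?thesis using c(2) unfolding h_def i by (simp add: A_def)
  qed
  have "block_entropy n \<le> partition_entropy M (iterated_join M T P n)" for n
    unfolding partition_entropy_join[OF P] block_entropy_def
    by (rule shannon_le_compose[OF simple_itinerary[OF P], where g="map h"])
      (simp add: word_def itinerary_def space_M h iterate_into w_iterate)
  then have "limsup (\<lambda>n. ereal (block_entropy n / n)) \<le>
    limsup (\<lambda>n. ereal (partition_entropy M (iterated_join M T P n) / n))"
    by (intro Limsup_mono always_eventually) (auto intro: divide_right_mono)
  also have "\<dots> \<le> metric_entropy M T"
    unfolding metric_entropy_def using P by (intro SUP_upper) simp
  finally show ?thesis .
qed

text \<open>Entropy \<open>ln 3\<close> leaves no slack in \<open>metric_entropy_le\<close> for any
  block length, so every block entropy attains its maximum \<open>n * ln 3\<close>;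
  \<open>shannon_max_imp_uniform\<close> then gives the word probabilities. Conversely, uniform
  words have these block entropies and \<open>metric_entropy_ge\<close> applies.\<close>

theorem metric_entropy_maximal_iff:
  "metric_entropy M T = topological_entropy T K \<longleftrightarrow>
     (\<forall>n. \<forall>v\<in>words n. prob {p \<in> K. word (w p) 0 n = v} = 1 / 3 ^ n)"
  (is "_ \<longleftrightarrow> ?U")
proof
  have vals: "(\<lambda>p. word (w p) 0 n) ` space M \<subseteq> words n" for n
    by (auto simp: space_M intro!: word_in_words w_into)
  have pre: "(\<lambda>p. word (w p) 0 n) -` {v} \<inter> space M = {p \<in> K. word (w p) 0 n = v}" for n v
    by (auto simp: space_M)
  {
    assume "metric_entropy M T = topological_entropy T K"
    then have max: "ln 3 \<le> block_entropy n / n" if "n > 0" for n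
      using metric_entropy_le[OF that] by (simp add: topological_entropy_eq)
    show ?U
    proof (intro allI ballI)
      fix n v assume v: "v \<in> words n"
      have "n * ln 3 \<le> block_entropy n"
      proof (cases "n = 0")
        case True
        have "block_entropy 0 \<ge> 0" using block_entropy_add[of 0 0] by simp
        then show ?thesis using True by simp
      next
        case False
        then show ?thesis using max[of n] by (simp add: field_simps)
      qed
      then have "block_entropy n = ln (card (words n))"
        using block_entropy_le[of n] by (simp add: ln_realpow)
      then have "prob ((\<lambda>p. word (w p) 0 n) -` {v} \<inter> space M) = 1 / card (words n)"
        unfolding block_entropy_def by (rule shannon_max_imp_uniform[OF simple_word finite_words vals _ v])
      then show "prob {p \<in> K. word (w p) 0 n = v} = 1 / 3 ^ n" by (simp add: pre)
    qed
  }
  assume U: ?U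
  have "block_entropy n = n * ln 3" for n
  proof -
    have "block_entropy n = - (\<Sum>v\<in>words n. 1 / 3 ^ n * ln (1 / 3 ^ n))"
      unfolding block_entropy_def shannon_superset[OF finite_words vals] pre
      using U by (intro arg_cong[where f=uminus] sum.cong) auto
    then show ?thesis by (simp add: ln_div ln_realpow)
  qed
  note be = this
  have "ereal (ln 3) = limsup (\<lambda>n. ereal (ln 3))" by (simp add: Limsup_const)
  also have "\<dots> \<le> limsup (\<lambda>n. ereal (block_entropy n / n))"
    by (intro Limsup_mono eventually_sequentiallyI[of 1]) (simp add: be)
  also have "\<dots> \<le> metric_entropy M T" by (rule metric_entropy_ge)
  finally have "ereal (ln 3) \<le> metric_entropy M T" .
  moreover have "metric_entropy M T \<le> ereal (ln 3)"
    using metric_entropy_le[of 1] by (simp add: be)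
  ultimately show "metric_entropy M T = topological_entropy T K" by (simp add: topological_entropy_eq)
qed

end


section \<open>Uniformly distributed codings\<close>

text \<open>Words at every position are prescribed, including negative ones: this fixes the joint
  law of all symbols and covers the past, from which the fibre contraction is read.\<close>

definition uniform_coding :: "'a measure \<Rightarrow> ('a \<Rightarrow> int \<Rightarrow> nat) \<Rightarrow> bool" where
  "uniform_coding M W \<longleftrightarrow> prob_space M \<and>
     (\<forall>j. (\<lambda>x. W x j) \<in> measurable M (count_space UNIV)) \<and>
     (\<forall>x\<in>space M. W x \<in> full_shift_space) \<and>
     (\<forall>a n. \<forall>v\<in>words n. measure M {x \<in> space M. word (W x) a n = v} = 1 / 3 ^ n)"

lemma measure_uniform_coding:
  assumes "uniform_coding M W"
  shows "measure M {x \<in> space M. Q (word (W x) a n)} = card {v \<in> words n. Q v} / 3 ^ n"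
    and "{x \<in> space M. Q (word (W x) a n)} \<in> sets M"
proof -
  interpret prob_space M using assms by (simp add: uniform_coding_def)
  have [measurable]: "(\<lambda>x. W x j) \<in> measurable M (count_space UNIV)" for j
    using assms by (simp add: uniform_coding_def)
  have W: "W x \<in> full_shift_space" if "x \<in> space M" for x
    using assms that by (simp add: uniform_coding_def)
  let ?A = "\<lambda>v. {x \<in> space M. word (W x) a n = v}"
  have A: "?A v \<in> events" for v
  proof -
    have "?A v = (if length v = n then {x \<in> space M. \<forall>i<n. W x (a + int i) = v ! i} else {})"
      by (simp add: word_eq_list_iff)
    also have "\<dots> \<in> events" by auto
    finally show ?thesis .
  qed
  have eq: "{x \<in> space M. Q (word (W x) a n)} = (\<Union>v\<in>{v \<in> words n. Q v}. ?A v)"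
    using word_in_words[OF W] by auto
  have fin: "finite {v \<in> words n. Q v}" by simp
  show "{x \<in> space M. Q (word (W x) a n)} \<in> sets M"
    unfolding eq by (rule sets.finite_UN[OF fin A])
  have "prob (\<Union>v\<in>{v \<in> words n. Q v}. ?A v) = (\<Sum>v\<in>{v \<in> words n. Q v}. prob (?A v))"
    using A by (intro finite_measure_finite_Union fin) (auto simp: disjoint_family_on_def)
  also have "\<dots> = (\<Sum>v\<in>{v \<in> words n. Q v}. 1 / 3 ^ n)"
    using assms by (intro sum.cong) (auto simp: uniform_coding_def)
  finally show "measure M {x \<in> space M. Q (word (W x) a n)} = card {v \<in> words n. Q v} / 3 ^ n"
    unfolding eq by simp
qed

section \<open>Average contraction along random words\<close>

lemma sum_words_prod: "(\<Sum>v\<in>words n. prod_list (map h v)) = (\<Sum>i<3. h i :: real) ^ n"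
proof (induction n)
  case 0
  have "words 0 = {[]}" by (auto simp: words_def)
  then show ?case by simp
next
  case (Suc n)
  have "words (Suc n) = (\<lambda>(x, v). x # v) ` ({..<3} \<times> words n)"
    by (force simp: words_def length_Suc_conv image_iff)
  then have "(\<Sum>v\<in>words (Suc n). prod_list (map h v)) = (\<Sum>(x, v)\<in>{..<3} \<times> words n. h x * prod_list (map h v))"
    by (simp add: sum.reindex inj_on_def case_prod_unfold)
  also have "\<dots> = (\<Sum>x<3. h x) * (\<Sum>v\<in>words n. prod_list (map h v))"
    by (simp add: sum_product sum.cartesian_product)
  finally show ?case using Suc by simp
qed

text \<open>The mean of \<open>b i powr s\<close> equals 1 at \<open>s = 0\<close>, and its
  derivative there is the mean of the \<open>ln (b i)\<close>, negative because the product of the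
  \<open>b i\<close> is below 1. Hence it drops below 1 for small positive \<open>s\<close>.\<close>

lemma exists_contracting_moment:
  fixes b :: "nat \<Rightarrow> real"
  assumes pos: "\<And>i. i < 3 \<Longrightarrow> b i > 0" and prod: "(\<Prod>i<3. b i) < 1"
  shows "\<exists>s>0. (\<Sum>i<3. b i powr s) / 3 < 1"
proof -
  let ?g = "\<lambda>s. (\<Sum>i<3. b i powr s) / 3"
  have "((\<lambda>s. b i powr s) has_real_derivative b i powr 0 * ln (b i)) (at 0)" if "i < 3" for i
    using pos[OF that] by (auto intro!: derivative_eq_intros)
  then have "(?g has_real_derivative (\<Sum>i<3. b i powr 0 * ln (b i)) / 3) (at 0)"
    by (intro DERIV_cdivide DERIV_sum) auto
  moreover have "(\<Sum>i<3. b i powr 0 * ln (b i)) / 3 < 0"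
  proof -
    have "b i \<noteq> 0" if "i < 3" for i using pos[OF that] by simp
    then have "(\<Sum>i<3. b i powr 0 * ln (b i)) = ln (\<Prod>i<3. b i)"
      using pos by (subst ln_prod) (auto intro!: sum.cong)
    also have "\<dots> < 0" using prod pos by (subst ln_less_zero_iff) (auto intro!: prod_pos)
    finally show ?thesis by simp
  qed
  ultimately obtain d where d: "d > 0" "\<And>h. h > 0 \<Longrightarrow> h < d \<Longrightarrow> ?g (0 + h) < ?g 0"
    using DERIV_neg_dec_right by blast
  have "?g 0 = 1" using pos[of 0] pos[of 1] pos[of 2] by (simp add: numeral_3_eq_3 numeral_2_eq_2)
  then have "?g (d / 2) < 1" using d(2)[of "d / 2"] d(1) by simp
  then show ?thesis using d(1) by (intro exI[of _ "d / 2"]) simp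
qed

text \<open>A fractional moment replaces the law of large numbers.\<close>

lemma AE_backward_products_small:
  fixes b :: "nat \<Rightarrow> real"
  assumes U: "uniform_coding M W"
    and pos: "\<And>i. i < 3 \<Longrightarrow> b i > 0" and prod: "(\<Prod>i<3. b i) < 1"
  shows "AE x in M. \<forall>c>0. \<exists>n. prod_list (map b (word (W x) (- int n) n)) < c"
proof -
  interpret prob_space M using U by (simp add: uniform_coding_def)
  obtain s where s: "s > 0" "(\<Sum>i<3. b i powr s) / 3 < 1"
    using exists_contracting_moment[OF pos prod] by blast
  let ?r = "(\<Sum>i<3. b i powr s) / 3"
  let ?l = "\<lambda>x n. prod_list (map b (word (W x) (- int n) n))"
  have r0: "?r \<ge> 0" by (simp add: sum_nonneg)
  have powr_prod: "prod_list (map b v) > 0 \<and> prod_list (map b v) powr s = prod_list (map (\<lambda>i. b i powr s) v)"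
    if "set v \<subseteq> {..<3}" for v
    using that by (induction v) (auto simp: powr_mult pos order_less_imp_le)
  have small: "AE x in M. \<exists>n. ?l x n < c" if c: "c > 0" for c
  proof -
    \<comment> \<open>Markov's inequality for the \<open>s\<close>-th moment, carried out by
      counting words; the moment factorises by \<open>sum_words_prod\<close>.\<close>
    have bound: "prob {x \<in> space M. ?l x n \<ge> c} \<le> ?r ^ n / c powr s" for n
    proof -
      have "real (card {v \<in> words n. prod_list (map b v) \<ge> c}) = (\<Sum>v\<in>{v \<in> words n. prod_list (map b v) \<ge> c}. 1)"
        by simp
      also have "\<dots> \<le> (\<Sum>v\<in>{v \<in> words n. prod_list (map b v) \<ge> c}. prod_list (map (\<lambda>i. b i powr s) v) / c powr s)"
      proof (rule sum_mono)
        fix v assume v: "v \<in> {v \<in> words n. prod_list (map b v) \<ge> c}"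
        then have "c powr s \<le> prod_list (map b v) powr s" using c s by (intro powr_mono2) auto
        also have "\<dots> = prod_list (map (\<lambda>i. b i powr s) v)" using v powr_prod by (auto simp: words_def)
        finally show "1 \<le> prod_list (map (\<lambda>i. b i powr s) v) / c powr s" using c by simp
      qed
      also have "\<dots> \<le> (\<Sum>v\<in>words n. prod_list (map (\<lambda>i. b i powr s) v) / c powr s)"
      proof (rule sum_mono2)
        fix v assume "v \<in> words n - {v \<in> words n. prod_list (map b v) \<ge> c}"
        then have "prod_list (map (\<lambda>i. b i powr s) v) = prod_list (map b v) powr s"
          using powr_prod[of v] by (auto simp: words_def)
        then show "0 \<le> prod_list (map (\<lambda>i. b i powr s) v) / c powr s" by simp
      qed auto
      also have "\<dots> = (\<Sum>i<3. b i powr s) ^ n / c powr s"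
        by (simp add: sum_divide_distrib[symmetric] sum_words_prod)
      finally have "real (card {v \<in> words n. prod_list (map b v) \<ge> c}) / 3 ^ n \<le> (\<Sum>i<3. b i powr s) ^ n / c powr s / 3 ^ n"
        by (rule divide_right_mono) simp
      also have "\<dots> = ?r ^ n / c powr s" by (simp add: power_divide)
      finally show ?thesis
        using measure_uniform_coding(1)[OF U, of "\<lambda>v. prod_list (map b v) \<ge> c" "- int n" n] by simp
    qed
    have ev: "{x \<in> space M. ?l x n \<ge> c} \<in> events" for n
      using measure_uniform_coding(2)[OF U, of "\<lambda>v. prod_list (map b v) \<ge> c" "- int n" n] .
    \<comment> \<open>Failure for all \<open>n\<close> at once lies inside each single failure
      event, and the probabilities of these decay geometrically.\<close>
    let ?N = "\<Inter>n. {x \<in> space M. ?l x n \<ge> c}"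
    have N: "?N \<in> events" using ev by (intro sets.countable_INT) auto
    have "prob ?N \<le> ?r ^ n / c powr s" for n
      using finite_measure_mono[of ?N "{x \<in> space M. ?l x n \<ge> c}"] ev bound[of n] by fastforce
    moreover have "(\<lambda>n. ?r ^ n / c powr s) \<longlonglongrightarrow> 0 / c powr s"
      using c s(2) r0 by (intro tendsto_divide LIMSEQ_power_zero tendsto_const) auto
    ultimately have "prob ?N \<le> 0"
      by (intro LIMSEQ_le_const[of "\<lambda>n. ?r ^ n / c powr s"]) auto
    then have "emeasure M ?N = 0" by (simp add: emeasure_eq_measure measure_le_0_iff)
    then show ?thesis using N by (intro AE_I[of _ _ ?N]) (auto simp: not_less)
  qed
  \<comment> \<open>Uncountably many \<open>c\<close> are reduced to the countable family
    \<open>1 / Suc m\<close>.\<close>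
  have "AE x in M. \<forall>m. \<exists>n. ?l x n < 1 / real (Suc m)"
    unfolding AE_all_countable using small by simp
  then show ?thesis
  proof (rule AE_mp, intro AE_I2 impI allI)
    fix x and c :: real
    assume H: "\<forall>m. \<exists>n. ?l x n < 1 / real (Suc m)" and "c > 0"
    then obtain m where m: "1 / real (Suc m) < c" by (metis nat_approx_posE)
    obtain n where "?l x n < 1 / real (Suc m)" using H by blast
    then show "\<exists>n. ?l x n < c" using m by (intro exI[of _ n]) linarith
  qed
qed

section \<open>The Bernoulli measure on two-sided sequences\<close>

definition bernoulli :: "(int \<Rightarrow> nat) measure" where
  "bernoulli = PiM UNIV (\<lambda>_. uniform_count_measure {..<3})"

lemma prob_space_uniform3: "prob_space (uniform_count_measure {..<3::nat})"
  by (rule prob_space_uniform_count_measure) (auto simp: lessThan_empty_iff)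

interpretation bernoulli: product_prob_space "\<lambda>_. uniform_count_measure {..<3::nat}" "UNIV :: int set"
  by (intro product_prob_spaceI prob_space_uniform3)

lemma space_bernoulli: "space bernoulli = full_shift_space"
  by (auto simp: bernoulli_def space_PiM full_shift_space_def space_uniform_count_measure)

lemma measurable_bernoulli_coord: "(\<lambda>\<omega>. \<omega> j) \<in> measurable bernoulli (count_space UNIV)"
proof -
  have "(\<lambda>\<omega>. \<omega> j) \<in> measurable bernoulli (uniform_count_measure {..<3})"
    unfolding bernoulli_def by (rule measurable_component_singleton) simp
  moreover have "(\<lambda>x. x) \<in> measurable (uniform_count_measure {..<3::nat}) (count_space UNIV)"
    by (auto simp: measurable_def sets_uniform_count_measure space_uniform_count_measure)
  ultimately show ?thesis by (rule measurable_compose)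
qed

lemma uniform_coding_bernoulli: "uniform_coding bernoulli (\<lambda>\<omega>. \<omega>)"
  unfolding uniform_coding_def
proof (intro conjI allI ballI)
  show "prob_space bernoulli" unfolding bernoulli_def by (rule prob_space_PiM[OF prob_space_uniform3])
  fix a :: int and n :: nat and v assume v: "v \<in> words n"
  let ?J = "{a..<a + int n}"
  let ?X = "\<lambda>j. {v ! nat (j - a)}"
  have vj: "v ! nat (j - a) < 3" if "j \<in> ?J" for j
  proof -
    have "nat (j - a) < length v" using that v by (auto simp: words_def)
    then show ?thesis using v nth_mem by (fastforce simp: words_def)
  qed
  have iff: "word \<omega> a n = v \<longleftrightarrow> (\<forall>j\<in>?J. \<omega> j = v ! nat (j - a))" for \<omega>
  proof -
    have "word (\<lambda>j. v ! nat (j - a)) a n = v"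
      using v by (intro nth_equalityI) (auto simp: word_def words_def)
    then show ?thesis using word_eq_iff[of \<omega> a n "\<lambda>j. v ! nat (j - a)"] by simp
  qed
  have "{\<omega> \<in> space bernoulli. word \<omega> a n = v} =
      prod_emb UNIV (\<lambda>_. uniform_count_measure {..<3}) ?J (Pi\<^sub>E ?J ?X)"
    unfolding iff by (auto simp: prod_emb_def space_bernoulli full_shift_space_def space_uniform_count_measure PiE_iff)
  also have "measure bernoulli \<dots> = (\<Prod>j\<in>?J. measure (uniform_count_measure {..<3}) (?X j))"
    unfolding bernoulli_def
    using vj by (intro bernoulli.measure_PiM_emb) (auto simp: sets_uniform_count_measure)
  also have "\<dots> = (\<Prod>j\<in>?J. 1 / 3)"
    using vj by (intro prod.cong) (auto simp: measure_uniform_count_measure)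
  finally show "measure bernoulli {\<omega> \<in> space bernoulli. word \<omega> a n = v} = 1 / 3 ^ n"
    by (simp add: power_one_over)
qed (auto simp: space_bernoulli intro: measurable_bernoulli_coord)

lemma measurable_uniform_coding:
  assumes U: "uniform_coding M W"
  shows "W \<in> measurable M bernoulli"
  unfolding bernoulli_def
proof (rule measurable_PiM_single')
  show "W \<in> space M \<rightarrow> (\<Pi>\<^sub>E i\<in>UNIV. space (uniform_count_measure {..<3}))"
    using U by (auto simp: uniform_coding_def full_shift_space_def space_uniform_count_measure)
  fix j :: int
  have "(\<lambda>x. W x j) \<in> measurable M (count_space UNIV)" using U by (simp add: uniform_coding_def)
  then show "(\<lambda>x. W x j) \<in> measurable M (uniform_count_measure {..<3})"
    using U by (auto simp: measurable_def sets_uniform_count_measure space_uniform_count_measure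
        uniform_coding_def full_shift_space_def)
qed

text \<open>A product measure is determined by finite-dimensional boxes. The finitely many
  coordinates of a box lie in one window, on which both measures count the same words.\<close>

lemma distr_uniform_coding:
  assumes U: "uniform_coding M W"
  shows "distr M bernoulli W = bernoulli"
proof -
  let ?u = "\<lambda>_::int. uniform_count_measure {..<3::nat}"
  interpret M: prob_space M using U by (simp add: uniform_coding_def)
  interpret B: prob_space bernoulli using uniform_coding_bernoulli by (simp add: uniform_coding_def)
  note W = measurable_uniform_coding[OF U]
  have "distr M bernoulli W = PiM UNIV ?u"
  proof (rule bernoulli.PiM_eq)
    show "sets (distr M bernoulli W) = sets (PiM UNIV ?u)" by (simp add: bernoulli_def)
    fix J :: "int set" and A :: "int \<Rightarrow> nat set"
    assume J: "finite J" and A: "\<And>j. j \<in> J \<Longrightarrow> A j \<in> sets (uniform_count_measure {..<3})"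
    let ?E = "prod_emb UNIV ?u J (Pi\<^sub>E J A)"
    \<comment> \<open>The strict bound puts \<open>J\<close> inside the positions \<open>- m\<close>
      to \<open>m - 1\<close>, a window of length \<open>2 * m\<close>.\<close>
    have "\<exists>m::nat. \<forall>j\<in>J. \<bar>j\<bar> < int m"
    proof (intro exI[of _ "Suc (nat (\<Sum>j\<in>J. \<bar>j\<bar>))"] ballI)
      fix j assume "j \<in> J"
      then have "\<bar>j\<bar> \<le> (\<Sum>j\<in>J. \<bar>j\<bar>)" using J by (intro member_le_sum) auto
      then show "\<bar>j\<bar> < int (Suc (nat (\<Sum>j\<in>J. \<bar>j\<bar>)))" by linarith
    qed
    then obtain m :: nat where m: "\<And>j. j \<in> J \<Longrightarrow> \<bar>j\<bar> < int m" by blast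
    let ?Q = "\<lambda>v. \<forall>j\<in>J. v ! nat (j + int m) \<in> A j"
    have Q: "?Q (word \<omega> (- int m) (2 * m)) \<longleftrightarrow> (\<forall>j\<in>J. \<omega> j \<in> A j)" for \<omega>
    proof -
      have "word \<omega> (- int m) (2 * m) ! nat (j + int m) = \<omega> j" if "j \<in> J" for j
        using m[OF that] by (auto simp: word_def)
      then show ?thesis by simp
    qed
    have E: "?E = {\<omega> \<in> space bernoulli. ?Q (word \<omega> (- int m) (2 * m))}"
      unfolding Q by (auto simp: prod_emb_def space_bernoulli full_shift_space_def space_uniform_count_measure PiE_iff)
    have EB: "?E \<in> sets bernoulli"
      unfolding E by (rule measure_uniform_coding(2)[OF uniform_coding_bernoulli])
    have "W -` ?E \<inter> space M = {x \<in> space M. ?Q (word (W x) (- int m) (2 * m))}"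
      unfolding E using measurable_space[OF W] by auto
    then have "measure (distr M bernoulli W) ?E = measure M {x \<in> space M. ?Q (word (W x) (- int m) (2 * m))}"
      by (simp add: measure_distr[OF W EB])
    also have "\<dots> = measure bernoulli {\<omega> \<in> space bernoulli. ?Q (word \<omega> (- int m) (2 * m))}"
      unfolding measure_uniform_coding(1)[OF U, of ?Q]
        measure_uniform_coding(1)[OF uniform_coding_bernoulli, of ?Q] ..
    finally have "measure (distr M bernoulli W) ?E = measure bernoulli ?E" unfolding E .
    then have "emeasure (distr M bernoulli W) ?E = emeasure bernoulli ?E"
      using finite_measure.emeasure_eq_measure[OF prob_space.finite_measure[OF M.prob_space_distr[OF W]]] B.emeasure_eq_measure by simp
    also have "\<dots> = (\<Prod>j\<in>J. emeasure (uniform_count_measure {..<3}) (A j))"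
      unfolding bernoulli_def using J A by (intro emeasure_PiM_emb prob_space_uniform3) auto
    finally show "emeasure (distr M bernoulli W) ?E = (\<Prod>j\<in>J. emeasure (uniform_count_measure {..<3}) (A j))" .
  qed
  then show ?thesis by (simp add: bernoulli_def)
qed

lemma uniform_coding_shift: "uniform_coding M W \<Longrightarrow> uniform_coding M (\<lambda>x. shift (W x))"
  unfolding uniform_coding_def word_shift by (auto simp: shift_def full_shift_space_def)

lemma distr_bernoulli_shift: "distr bernoulli bernoulli shift = bernoulli"
  by (rule distr_uniform_coding[OF uniform_coding_shift[OF uniform_coding_bernoulli]])


text \<open>The entropy criterion concerns words at position 0; invariance carries it to all
  positions. The result is phrased by \<open>uniform_coding\<close> so that comparison with
  \<open>bernoulli\<close> can start.\<close>

lemma (in shift_extension) measure_of_maximal_entropy_iff: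
  "measure_of_maximal_entropy T K M \<longleftrightarrow> invariant_borel_probability T K M \<and> uniform_coding M w"
proof (cases "invariant_borel_probability T K M")
  case True
  interpret shift_extension_measure T K w M by unfold_locales (rule True)
  have prob_word: "prob {p \<in> space M. word (w p) a n = v} = prob {p \<in> space M. word (w p) 0 n = v}" for a n v
  proof -
    have W: "{p \<in> space M. word (w p) b n = v} \<in> events" for b
      using simple_functionD(2)[OF simple_word[of b n], of "{v}"] by (simp add: vimage_def Int_def conj_commute)
    have step: "prob {p \<in> space M. word (w p) (b + int i) n = v} = prob {p \<in> space M. word (w p) b n = v}" for b i
    proof -
      have "{p \<in> space M. word (w p) (b + int i) n = v} = (T ^^ i) -` {p \<in> space M. word (w p) b n = v} \<inter> space M"
        by (auto simp: space_M word_iterate iterate_into)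
      then show ?thesis using measure_iterate[OF W[of b], of i] by simp
    qed
    show ?thesis
    proof (cases "a \<ge> 0")
      case True then show ?thesis using step[of 0 "nat a"] by simp
    next
      case False then show ?thesis using step[of a "nat (- a)"] by simp
    qed
  qed
  have "uniform_coding M w \<longleftrightarrow>
    (\<forall>a n. \<forall>v\<in>words n. prob {p \<in> space M. word (w p) a n = v} = 1 / 3 ^ n)"
    using prob_space_axioms measurable_w w_into by (simp add: uniform_coding_def space_M)
  also have "\<dots> \<longleftrightarrow> (\<forall>n. \<forall>v\<in>words n. prob {p \<in> space M. word (w p) 0 n = v} = 1 / 3 ^ n)"
  proof
    assume "\<forall>a n. \<forall>v\<in>words n. prob {p \<in> space M. word (w p) a n = v} = 1 / 3 ^ n"
    then show "\<forall>n. \<forall>v\<in>words n. prob {p \<in> space M. word (w p) 0 n = v} = 1 / 3 ^ n" by (rule spec)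
  next
    assume *: "\<forall>n. \<forall>v\<in>words n. prob {p \<in> space M. word (w p) 0 n = v} = 1 / 3 ^ n"
    show "\<forall>a n. \<forall>v\<in>words n. prob {p \<in> space M. word (w p) a n = v} = 1 / 3 ^ n"
    proof (intro allI ballI)
      fix a n v assume v: "v \<in> words n"
      have "prob {p \<in> space M. word (w p) a n = v} = prob {p \<in> space M. word (w p) 0 n = v}" by (rule prob_word)
      also have "\<dots> = 1 / 3 ^ n" by (rule bspec[OF spec[OF *] v])
      finally show "prob {p \<in> space M. word (w p) a n = v} = 1 / 3 ^ n" .
    qed
  qed
  also have "\<dots> \<longleftrightarrow> metric_entropy M T = topological_entropy T K"
    unfolding metric_entropy_maximal_iff space_M ..
  finally have "metric_entropy M T = topological_entropy T K \<longleftrightarrow> uniform_coding M w" by (rule sym)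
  then show ?thesis using True by (simp add: measure_of_maximal_entropy_def)
qed (simp add: measure_of_maximal_entropy_def)


section \<open>Step skew products over the horseshoe\<close>

lemma compact_full_shift_space: "compact full_shift_space"
proof -
  have eq: "full_shift_space = PiE UNIV (\<lambda>_. {..<3})" by (auto simp: full_shift_space_def)
  have "compactin (product_topology (\<lambda>_. euclidean) (UNIV :: int set)) (PiE UNIV (\<lambda>_. {..<3::nat}))"
    unfolding compactin_PiE by (auto simp: finite_imp_compact)
  then show ?thesis unfolding euclidean_product_topology compactin_euclidean_iff eq .
qed

text \<open>The bound \<open>b\<close> depends on the symbol alone, so products along words bound
  iterates; single entries may exceed 1. \<open>monotone\<close> serves the counting of labels,
  \<open>contraction\<close> the collapse of almost every fibre, and \<open>df_nonzero\<close> keeps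
  the logarithm in the central exponent continuous.\<close>

locale horseshoe_skew =
  fixes \<Phi> :: "plane \<Rightarrow> plane" and R :: "nat \<Rightarrow> plane set" and \<Gamma> :: "plane set"
    and \<pi> :: "plane \<Rightarrow> int \<Rightarrow> nat" and cs ex :: "nat \<Rightarrow> real"
    and f df :: "nat \<Rightarrow> real \<Rightarrow> real" and b :: "nat \<Rightarrow> real"
  assumes horseshoe: "three_legged_horseshoe \<Phi> R \<Gamma> \<pi> cs ex"
    and fibers: "C1_fiber_maps f df"
    and monotone: "i < 3 \<Longrightarrow> mono_on {0..1} (f i) \<or> antimono_on {0..1} (f i)"
    and df_bound: "i < 3 \<Longrightarrow> x \<in> {0..1} \<Longrightarrow> \<bar>df i x\<bar> \<le> b i"
    and df_nonzero: "i < 3 \<Longrightarrow> x \<in> {0..1} \<Longrightarrow> df i x \<noteq> 0"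
    and contraction: "(\<Prod>i<3. b i) < 1"
begin

abbreviation "G \<equiv> skew_product \<Phi> R f"
abbreviation "\<Lambda> \<equiv> maximal_invariant_set G (skew_domain R)"
abbreviation "w \<equiv> \<lambda>p :: plane \<times> real. \<pi> (fst p)"

lemma b_pos: "i < 3 \<Longrightarrow> b i > 0"
  using df_bound[of i 0] df_nonzero[of i 0] by force

lemma \<Gamma>_eq: "\<Gamma> = maximal_invariant_set \<Phi> (\<Union>i<3. R i)"
  and \<pi>_\<Phi>: "X \<in> \<Gamma> \<Longrightarrow> \<pi> (\<Phi> X) = shift (\<pi> X)"
  and R_iff: "X \<in> \<Gamma> \<Longrightarrow> i < 3 \<Longrightarrow> X \<in> R i \<longleftrightarrow> \<pi> X 0 = i"
  using horseshoe unfolding three_legged_horseshoe_def by blast+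

definition decode :: "(int \<Rightarrow> nat) \<Rightarrow> plane" where
  "decode = (SOME \<pi>'. homeomorphism \<Gamma> full_shift_space \<pi> \<pi>')"

lemma homeo: "homeomorphism \<Gamma> full_shift_space \<pi> decode"
proof -
  have "\<exists>\<pi>'. homeomorphism \<Gamma> full_shift_space \<pi> \<pi>'"
    using horseshoe unfolding three_legged_horseshoe_def by blast
  then show ?thesis unfolding decode_def by (rule someI_ex)
qed

lemma \<pi>_into: "X \<in> \<Gamma> \<Longrightarrow> \<pi> X \<in> full_shift_space"
  and decode_into: "\<omega> \<in> full_shift_space \<Longrightarrow> decode \<omega> \<in> \<Gamma>"
  and decode_\<pi>: "X \<in> \<Gamma> \<Longrightarrow> decode (\<pi> X) = X"
  and \<pi>_decode: "\<omega> \<in> full_shift_space \<Longrightarrow> \<pi> (decode \<omega>) = \<omega>"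
  using homeomorphism_image1[OF homeo] homeomorphism_image2[OF homeo]
    homeomorphism_apply1[OF homeo] homeomorphism_apply2[OF homeo] by auto

lemma \<pi>_less: "X \<in> \<Gamma> \<Longrightarrow> \<pi> X j < 3"
  using \<pi>_into by (auto simp: full_shift_space_def)

lemma continuous_\<pi>: "continuous_on \<Gamma> (\<lambda>X. \<pi> X j)"
  by (rule continuous_on_product_then_coordinatewise[OF homeomorphism_cont1[OF homeo]])

lemma compact_\<Gamma>: "compact \<Gamma>"
proof -
  have "\<Gamma> = decode ` full_shift_space" "continuous_on full_shift_space decode"
    using homeomorphism_image2[OF homeo] homeomorphism_cont2[OF homeo] by auto
  then show ?thesis using compact_continuous_image[OF _ compact_full_shift_space] by metis
qed

lemma inj_\<Phi>: "inj \<Phi>" and continuous_\<Phi>: "continuous_on S \<Phi>"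
proof -
  have C: "C1_diffeomorphism \<Phi>" using horseshoe by (simp add: three_legged_horseshoe_def)
  then show "inj \<Phi>" by (auto simp: C1_diffeomorphism_def bij_def)
  obtain g' where "\<forall>x. (\<Phi> has_derivative blinfun_apply (g' x)) (at x)"
    using C by (auto simp: C1_diffeomorphism_def C1_map_def)
  then show "continuous_on S \<Phi>"
    by (intro continuous_at_imp_continuous_on ballI has_derivative_continuous) blast
qed

lemma \<Gamma>_orbit:
  assumes "X \<in> \<Gamma>"
  obtains z :: "int \<Rightarrow> plane" where "z 0 = X" "\<And>n. z n \<in> \<Gamma>" "\<And>n. z (n + 1) = \<Phi> (z n)"
proof -
  obtain z where z: "z 0 = X" "\<And>n::int. z n \<in> (\<Union>i<3. R i)" "\<And>n. z (n + 1) = \<Phi> (z n)"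
    using assms unfolding \<Gamma>_eq maximal_invariant_set_def by blast
  have "z n \<in> \<Gamma>" for n
    unfolding \<Gamma>_eq maximal_invariant_set_def
    using z by (intro CollectI exI[of _ "\<lambda>k. z (n + k)"]) (simp add: add.assoc[symmetric])
  then show ?thesis using that z by blast
qed

lemma \<Phi>_into: "X \<in> \<Gamma> \<Longrightarrow> \<Phi> X \<in> \<Gamma>"
  by (rule \<Gamma>_orbit[of X], assumption) (metis add_0)

lemma \<Phi>_onto: "X \<in> \<Gamma> \<Longrightarrow> \<exists>Y\<in>\<Gamma>. \<Phi> Y = X"
  by (rule \<Gamma>_orbit[of X], assumption) (metis add.left_inverse)

lemma \<Phi>_pow_onto: "X \<in> \<Gamma> \<Longrightarrow> \<exists>Y\<in>\<Gamma>. (\<Phi> ^^ n) Y = X"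
proof (induction n arbitrary: X)
  case (Suc n)
  obtain Z where "Z \<in> \<Gamma>" "\<Phi> Z = X" using \<Phi>_onto[OF Suc.prems] by blast
  then show ?case using Suc.IH[of Z] by auto
qed auto

lemma symbol_index: "X \<in> \<Gamma> \<Longrightarrow> (THE i. i < 3 \<and> X \<in> R i) = \<pi> X 0"
  by (rule the_equality) (auto simp: R_iff \<pi>_less)

lemma G_eq: "X \<in> \<Gamma> \<Longrightarrow> G (X, x) = (\<Phi> X, f (\<pi> X 0) x)"
  by (simp add: skew_product_def symbol_index)

lemma fst_G: "fst (G p) = \<Phi> (fst p)"
  by (simp add: skew_product_def case_prod_unfold)

lemma fst_G_pow: "fst ((G ^^ n) p) = (\<Phi> ^^ n) (fst p)"
  by (induction n) (auto simp: fst_G)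

lemma f_into: "i < 3 \<Longrightarrow> x \<in> {0..1} \<Longrightarrow> f i x \<in> {0..1}"
  and f_inj: "i < 3 \<Longrightarrow> inj_on (f i) {0..1}"
  and f_deriv: "i < 3 \<Longrightarrow> x \<in> {0..1} \<Longrightarrow> (f i has_real_derivative df i x) (at x within {0..1})"
  and df_continuous: "i < 3 \<Longrightarrow> continuous_on {0..1} (df i)"
  using fibers unfolding C1_fiber_maps_def by blast+

lemma f_continuous: "i < 3 \<Longrightarrow> continuous_on {0..1} (f i)"
  using f_deriv by (intro DERIV_continuous_on)

lemma f_lipschitz:
  assumes "i < 3" "x \<in> {0..1}" "y \<in> {0..1}"
  shows "\<bar>f i x - f i y\<bar> \<le> b i * \<bar>x - y\<bar>"
  using field_differentiable_bound[of "{0..1::real}" "f i" "df i" "b i" x y] assms f_deriv df_bound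
  by (auto simp: real_norm_def)

abbreviation "cylinder \<equiv> \<Gamma> \<times> {0..1::real}"

lemma compact_cylinder: "compact cylinder"
  by (intro compact_Times compact_\<Gamma>) simp

lemma G_into_cylinder: "p \<in> cylinder \<Longrightarrow> G p \<in> cylinder"
  using f_into \<pi>_less \<Phi>_into by (cases p) (auto simp: G_eq)

lemma G_pow_into_cylinder: "p \<in> cylinder \<Longrightarrow> (G ^^ n) p \<in> cylinder"
  by (induction n) (simp_all only: funpow.simps id_apply comp_apply G_into_cylinder)

lemma inj_G: "inj_on G cylinder"
proof (rule inj_onI)
  fix p q assume p: "p \<in> cylinder" and q: "q \<in> cylinder" and eq: "G p = G q"
  obtain X x Y y where pq: "p = (X, x)" "q = (Y, y)" by (cases p, cases q)
  have "X = Y" using eq p q inj_\<Phi> unfolding pq by (auto simp: G_eq dest: injD)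
  moreover from this have "f (\<pi> X 0) x = f (\<pi> X 0) y" using eq p q unfolding pq by (auto simp: G_eq)
  then have "x = y" using inj_onD[OF f_inj[OF \<pi>_less[of X 0]]] p q unfolding pq by auto
  ultimately show "p = q" using pq by simp
qed

text \<open>The fibre map is selected by a locally constant symbol. A sum of fibre maps weighted by
  continuous indicators agrees with the \<open>THE\<close> in \<open>skew_product\<close> on the
  cylinder and is visibly continuous.\<close>

lemma continuous_G: "continuous_on cylinder G"
proof -
  have sym: "continuous_on cylinder (\<lambda>p. of_bool (\<pi> (fst p) 0 = i) :: real)" for i
  proof (rule continuous_on_compose2[of UNIV "\<lambda>j. of_bool (j = i)" _ "\<lambda>p. \<pi> (fst p) 0"])
    show "continuous_on cylinder (\<lambda>p. \<pi> (fst p) 0)"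
      by (rule continuous_on_compose2[OF continuous_\<pi>]) (auto intro: continuous_intros)
  qed auto
  have fib: "continuous_on cylinder (\<lambda>p. f i (snd p))" if "i < 3" for i
    by (rule continuous_on_compose2[OF f_continuous[OF that]]) (auto intro: continuous_intros)
  have "continuous_on cylinder (\<lambda>p. (\<Phi> (fst p), \<Sum>i<3. of_bool (\<pi> (fst p) 0 = i) * f i (snd p)))"
    by (intro continuous_intros sym fib continuous_on_compose2[OF continuous_\<Phi>[of UNIV]]) auto
  moreover have "(\<Phi> (fst p), \<Sum>i<3. of_bool (\<pi> (fst p) 0 = i) * f i (snd p)) = G p" if "p \<in> cylinder" for p
  proof -
    have "(\<Sum>i<3. of_bool (\<pi> (fst p) 0 = i) * f i (snd p)) = (\<Sum>i<3. if i = \<pi> (fst p) 0 then f i (snd p) else 0)"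
      by (intro sum.cong) auto
    also have "\<dots> = f (\<pi> (fst p) 0) (snd p)" using \<pi>_less[of "fst p" 0] that by auto
    finally show ?thesis using that by (cases p) (auto simp: G_eq)
  qed
  ultimately show ?thesis by (simp cong: continuous_on_cong)
qed

lemma continuous_G_pow: "continuous_on cylinder (G ^^ n)"
proof (induction n)
  case (Suc n)
  have "continuous_on cylinder (\<lambda>p. G ((G ^^ n) p))"
    by (rule continuous_on_compose2[OF continuous_G Suc]) (use G_pow_into_cylinder in blast)
  then show ?case by (simp add: comp_def)
qed (simp add: id_def)

lemma cylinder_subset: "cylinder \<subseteq> skew_domain R"
proof -
  have "\<Gamma> \<subseteq> (\<Union>i<3. R i)" using R_iff \<pi>_less by blast
  then show ?thesis by (auto simp: skew_domain_def)
qed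

lemma \<Lambda>_orbit:
  assumes "p \<in> \<Lambda>"
  obtains z :: "int \<Rightarrow> plane \<times> real" where "z 0 = p" "\<And>n. z n \<in> \<Lambda>" "\<And>n. z (n + 1) = G (z n)"
proof -
  obtain z where z: "z 0 = p" "\<And>n::int. z n \<in> skew_domain R" "\<And>n. z (n + 1) = G (z n)"
    using assms unfolding maximal_invariant_set_def by blast
  have "z n \<in> \<Lambda>" for n
    unfolding maximal_invariant_set_def
    using z by (intro CollectI exI[of _ "\<lambda>k. z (n + k)"]) (simp add: add.assoc[symmetric])
  then show ?thesis using that z by blast
qed

lemma \<Lambda>_subset: "\<Lambda> \<subseteq> cylinder"
proof
  fix p assume "p \<in> \<Lambda>"
  then obtain z where z: "z 0 = p" "\<And>n::int. z n \<in> skew_domain R" "\<And>n. z (n + 1) = G (z n)"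
    unfolding maximal_invariant_set_def by blast
  have "fst (z n) \<in> (\<Union>i<3. R i) \<and> fst (z (n + 1)) = \<Phi> (fst (z n))" for n
    using z(2)[of n] z(3)[of n] by (auto simp: skew_domain_def fst_G)
  then have "fst p \<in> \<Gamma>"
    unfolding \<Gamma>_eq maximal_invariant_set_def
    by (intro CollectI exI[of _ "\<lambda>n. fst (z n)"]) (simp add: z(1))
  then show "p \<in> cylinder" using z(1) z(2)[of 0] by (cases p) (auto simp: skew_domain_def)
qed

lemma G_into: "p \<in> \<Lambda> \<Longrightarrow> G p \<in> \<Lambda>"
  by (rule \<Lambda>_orbit[of p], assumption) (metis add_0)

lemma \<Lambda>_preimage: "p \<in> \<Lambda> \<Longrightarrow> \<exists>q\<in>\<Lambda>. (G ^^ n) q = p"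
proof (induction n arbitrary: p)
  case (Suc n)
  obtain q where "q \<in> \<Lambda>" "G q = p" using \<Lambda>_orbit[OF Suc.prems] by (metis add.left_inverse)
  then show ?case using Suc.IH[of q] by auto
qed auto

text \<open>Preimages of different orders are a priori unrelated. Injectivity of \<open>G\<close>
  makes each unique, so they line up into the backward half of one orbit. The intersection form
  makes \<open>\<Lambda>\<close> compact.\<close>

lemma \<Lambda>_eq_Inter: "\<Lambda> = (\<Inter>n. (G ^^ n) ` cylinder)"
proof (intro equalityI subsetI INT_I)
  fix p n assume "p \<in> \<Lambda>"
  then obtain q where "q \<in> \<Lambda>" "(G ^^ n) q = p" using \<Lambda>_preimage by blast
  then show "p \<in> (G ^^ n) ` cylinder" using \<Lambda>_subset by blast
next
  fix p assume p: "p \<in> (\<Inter>n. (G ^^ n) ` cylinder)"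
  define y where "y n = (SOME q. q \<in> cylinder \<and> (G ^^ n) q = p)" for n
  have y: "y n \<in> cylinder \<and> (G ^^ n) (y n) = p" for n
  proof -
    have "p \<in> (G ^^ n) ` cylinder" using p by (rule INT_D) simp
    then obtain q where "q \<in> cylinder" "(G ^^ n) q = p" by (elim imageE) metis
    then have "q \<in> cylinder \<and> (G ^^ n) q = p" by (rule conjI)
    then show ?thesis unfolding y_def by (rule someI)
  qed
  have inj: "q = q'" if "q \<in> cylinder" "q' \<in> cylinder" "(G ^^ n) q = (G ^^ n) q'" for q q' n
    using that
  proof (induction n)
    case (Suc n)
    then show ?case using inj_onD[OF inj_G, of "(G ^^ n) q" "(G ^^ n) q'"] G_pow_into_cylinder by simp
  qed simp
  have step: "G (y (Suc n)) = y n" for n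
  proof (rule inj[of _ _ n])
    have "(G ^^ n) (G (y (Suc n))) = (G ^^ Suc n) (y (Suc n))" by (simp only: funpow_Suc_right comp_apply)
    then show "(G ^^ n) (G (y (Suc n))) = (G ^^ n) (y n)" using y[of n] y[of "Suc n"] by metis
  qed (use y G_into_cylinder in metis)+
  define z where "z n = (if n \<ge> 0 then (G ^^ nat n) p else y (nat (- n)))" for n :: int
  have pK: "p \<in> cylinder" using y[of 0] by (metis funpow_0)
  have "z n \<in> skew_domain R" for n
    using cylinder_subset y G_pow_into_cylinder[OF pK] by (auto simp: z_def simp del: mem_Sigma_iff)
  moreover have "z (n + 1) = G (z n)" for n
  proof (cases "n \<ge> 0")
    case True
    then have "nat (n + 1) = Suc (nat n)" by simp
    then show ?thesis using True by (simp add: z_def)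
  next
    case False
    define m where "m = nat (- n - 1)"
    have m: "n = - int (Suc m)" using False by (simp add: m_def)
    have "z (n + 1) = y m" using m y[of 0] by (cases m) (auto simp: z_def nat_add_distrib)
    moreover have "z n = y (Suc m)" using m by (simp add: z_def nat_add_distrib)
    ultimately show ?thesis using step by simp
  qed
  moreover have "z 0 = p" by (simp add: z_def)
  ultimately show "p \<in> \<Lambda>" unfolding maximal_invariant_set_def by blast
qed

lemma compact_image: "compact ((G ^^ n) ` cylinder)"
  by (rule compact_continuous_image[OF continuous_G_pow compact_cylinder])

lemma compact_\<Lambda>: "compact \<Lambda>"
proof -
  have "closed \<Lambda>" unfolding \<Lambda>_eq_Inter by (intro closed_INT ballI compact_imp_closed compact_image)
  moreover have "\<Lambda> = cylinder \<inter> \<Lambda>" using \<Lambda>_subset by (simp only: Int_absorb1)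
  ultimately show ?thesis using compact_Int_closed[OF compact_cylinder] by metis
qed

lemma image_decreasing: "m \<le> n \<Longrightarrow> (G ^^ n) ` cylinder \<subseteq> (G ^^ m) ` cylinder"
proof
  fix p assume mn: "m \<le> n" and "p \<in> (G ^^ n) ` cylinder"
  then obtain q where q: "q \<in> cylinder" "p = (G ^^ n) q" by blast
  have "(G ^^ n) q = (G ^^ m) ((G ^^ (n - m)) q)"
    using mn by (metis comp_apply funpow_add le_add_diff_inverse)
  then show "p \<in> (G ^^ m) ` cylinder" using q G_pow_into_cylinder by blast
qed

text \<open>Over \<open>X\<close> the iterated images of the cylinder cut out nested compact sets.
  None is empty, because \<open>X\<close> has \<open>n\<close>-step preimages in
  \<open>\<Gamma>\<close>.\<close>

lemma fst_\<Lambda>: "fst ` \<Lambda> = \<Gamma>"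
proof (intro equalityI subsetI)
  fix X assume "X \<in> fst ` \<Lambda>"
  then show "X \<in> \<Gamma>" using \<Lambda>_subset by auto
next
  fix X assume X: "X \<in> \<Gamma>"
  define C where "C n = (G ^^ n) ` cylinder \<inter> {X} \<times> {0..1}" for n
  have "\<Inter> (range C) \<noteq> {}"
  proof (rule compact_nest)
    show "compact (C n)" for n unfolding C_def by (intro compact_Int compact_image compact_Times) auto
    show "C n \<subseteq> C m" if "m \<le> n" for m n using image_decreasing[OF that] by (auto simp: C_def)
    show "C n \<noteq> {}" for n
    proof -
      obtain Y where Y: "Y \<in> \<Gamma>" "(\<Phi> ^^ n) Y = X" using \<Phi>_pow_onto[OF X] by blast
      have q: "(Y, 0) \<in> cylinder" using Y by simp
      have "(G ^^ n) (Y, 0) \<in> cylinder" by (rule G_pow_into_cylinder[OF q])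
      moreover have "fst ((G ^^ n) (Y, 0)) = X" using Y by (simp add: fst_G_pow)
      ultimately have "(G ^^ n) (Y, 0) \<in> C n" unfolding C_def using q
        by (cases "(G ^^ n) (Y, 0)") (auto intro!: image_eqI[of _ _ "(Y, 0)"])
      then show ?thesis by blast
    qed
  qed
  then obtain p where "p \<in> \<Inter> (range C)" by blast
  then have "p \<in> \<Lambda>" "fst p = X" unfolding \<Lambda>_eq_Inter C_def by auto
  then show "X \<in> fst ` \<Lambda>" by blast
qed

lemma \<pi>_\<Phi>_pow: "X \<in> \<Gamma> \<Longrightarrow> \<pi> ((\<Phi> ^^ n) X) j = \<pi> X (j + int n) \<and> (\<Phi> ^^ n) X \<in> \<Gamma>"
  by (induction n arbitrary: j) (auto simp: \<pi>_\<Phi> shift_def \<Phi>_into ac_simps)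

lemma snd_G_Suc: "p \<in> cylinder \<Longrightarrow> snd ((G ^^ Suc n) p) = f (w p (int n)) (snd ((G ^^ n) p))"
proof -
  assume p: "p \<in> cylinder"
  obtain X x where q: "(G ^^ n) p = (X, x)" by (cases "(G ^^ n) p")
  have X: "X \<in> \<Gamma>" using G_pow_into_cylinder[OF p, of n] q by auto
  have "X = (\<Phi> ^^ n) (fst p)" using q fst_G_pow[of n p] by simp
  then have "\<pi> X 0 = w p (int n)" using \<pi>_\<Phi>_pow[of "fst p" n 0] p by auto
  then show ?thesis using q X by (simp add: G_eq)
qed

lemma snd_G_pow_range: "p \<in> cylinder \<Longrightarrow> snd ((G ^^ n) p) \<in> {0..1}"
  using G_pow_into_cylinder[of p n] by auto

text \<open>Trace both points back by \<open>n\<close> steps. Injectivity of \<open>\<Phi>\<close>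
  keeps them over one base point, their distance there is at most 1, and each step forward
  multiplies it by at most the bound of its symbol. Time 0 of the preimages is position
  \<open>- n\<close> of \<open>p\<close>, whence the past word.\<close>

lemma fiber_contraction:
  assumes "p \<in> \<Lambda>" "q \<in> \<Lambda>" "fst p = fst q"
  shows "\<bar>snd p - snd q\<bar> \<le> prod_list (map b (word (w p) (- int n) n))"
proof -
  obtain p' q' where p': "p' \<in> \<Lambda>" "(G ^^ n) p' = p" and q': "q' \<in> \<Lambda>" "(G ^^ n) q' = q"
    using \<Lambda>_preimage assms by metis
  have K: "p' \<in> cylinder" "q' \<in> cylinder" using p' q' \<Lambda>_subset by auto
  have "(\<Phi> ^^ n) (fst p') = (\<Phi> ^^ n) (fst q')" using assms(3) p' q' by (metis fst_G_pow)
  then have fst: "fst p' = fst q'" using inj_fn[OF inj_\<Phi>] by (metis injD)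
  have "\<bar>snd ((G ^^ m) p') - snd ((G ^^ m) q')\<bar> \<le> prod_list (map b (word (w p') 0 m))" for m
  proof (induction m)
    case 0
    then show ?case using K by (auto simp: word_def)
  next
    case (Suc m)
    have i: "w p' (int m) < 3" using K \<pi>_less by auto
    have "\<bar>snd ((G ^^ Suc m) p') - snd ((G ^^ Suc m) q')\<bar> \<le> b (w p' (int m)) * \<bar>snd ((G ^^ m) p') - snd ((G ^^ m) q')\<bar>"
      unfolding snd_G_Suc[OF K(1)] snd_G_Suc[OF K(2)] fst[symmetric]
      by (intro f_lipschitz i snd_G_pow_range K)
    also have "\<dots> \<le> b (w p' (int m)) * prod_list (map b (word (w p') 0 m))"
      using Suc b_pos[OF i] by (intro mult_left_mono) auto
    also have "\<dots> = prod_list (map b (word (w p') 0 (Suc m)))" by (simp add: word_def)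
    finally show ?case .
  qed
  from this[of n] have "\<bar>snd p - snd q\<bar> \<le> prod_list (map b (word (w p') 0 n))" using p' q' by simp
  also have "word (w p') 0 n = word (w p) (- int n) n"
  proof -
    have "fst p' \<in> \<Gamma>" using K by auto
    then have "w p (- int n + int i) = w p' (int i)" for i
      using \<pi>_\<Phi>_pow[of "fst p'" n "- int n + int i"] p'(2) fst_G_pow[of n p'] by simp
    then show ?thesis by (simp add: word_def)
  qed
  finally show ?thesis .
qed

text \<open>Otherwise the pairs at distance at least \<open>e\<close> with equal symbols up to
  \<open>k\<close> form nested nonempty compact sets. A common element would be two distinct points
  with the same coding.\<close>

lemma cylinders_shrink:
  assumes e: "e > 0"
  shows "\<exists>k::nat. \<forall>X\<in>\<Gamma>. \<forall>Y\<in>\<Gamma>. (\<forall>j. \<bar>j\<bar> \<le> int k \<longrightarrow> \<pi> X j = \<pi> Y j) \<longrightarrow> dist X Y < e"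
proof (rule ccontr)
  assume neg: "\<not> ?thesis"
  define C where "C k = {p \<in> \<Gamma> \<times> \<Gamma>. e \<le> dist (fst p) (snd p)} \<inter>
     (\<Inter>j\<in>{j. \<bar>j\<bar> \<le> int k}. {p \<in> \<Gamma> \<times> \<Gamma>. \<pi> (fst p) j = \<pi> (snd p) j})" for k :: nat
  have GG: "compact (\<Gamma> \<times> \<Gamma>)" by (intro compact_Times compact_\<Gamma>)
  have "\<Inter> (range C) \<noteq> {}"
  proof (rule compact_nest)
    fix k
    have "closed {p \<in> \<Gamma> \<times> \<Gamma>. e \<le> dist (fst p) (snd p)}"
      using compact_imp_closed[OF GG] by (intro continuous_on_closed_Collect_le continuous_intros) 
    moreover have "closed {p \<in> \<Gamma> \<times> \<Gamma>. \<pi> (fst p) j = \<pi> (snd p) j}" for j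
    proof -
      have "continuous_on (\<Gamma> \<times> \<Gamma>) (\<lambda>p. real (\<pi> (fst p) j))" "continuous_on (\<Gamma> \<times> \<Gamma>) (\<lambda>p. real (\<pi> (snd p) j))"
        by (rule continuous_on_compose2[of UNIV real], simp,
            rule continuous_on_compose2[OF continuous_\<pi>], auto intro: continuous_intros)+
      from continuous_closed_preimage[OF continuous_on_diff[OF this] compact_imp_closed[OF GG] closed_singleton[of 0]]
      show ?thesis by (simp add: vimage_def Int_def)
    qed
    ultimately have cl: "closed (C k)" unfolding C_def by (intro closed_Int closed_INT) auto
    have "C k = \<Gamma> \<times> \<Gamma> \<inter> C k" by (auto simp: C_def)
    then show "compact (C k)" using compact_Int_closed[OF GG cl] by simp
    obtain X Y where "X \<in> \<Gamma>" "Y \<in> \<Gamma>" "\<forall>j. \<bar>j\<bar> \<le> int k \<longrightarrow> \<pi> X j = \<pi> Y j" "\<not> dist X Y < e"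
      using neg by blast
    then have "(X, Y) \<in> C k" by (auto simp: C_def)
    then show "C k \<noteq> {}" by blast
  next
    show "C n \<subseteq> C m" if "m \<le> n" for m n using that by (auto simp: C_def)
  qed
  then obtain p where p: "p \<in> \<Inter> (range C)" by blast
  then have XY: "fst p \<in> \<Gamma>" "snd p \<in> \<Gamma>" "e \<le> dist (fst p) (snd p)" by (auto simp: C_def)
  have "\<pi> (fst p) j = \<pi> (snd p) j" for j
  proof -
    have "p \<in> C (nat \<bar>j\<bar>)" using p by blast
    then show ?thesis by (auto simp: C_def)
  qed
  then have "\<pi> (fst p) = \<pi> (snd p)" by (rule ext)
  then have "fst p = snd p" using decode_\<pi> XY by metis
  then show False using XY e by simp
qed

end


lemma dist_prod_le: "dist (p :: 'a::metric_space \<times> 'b::metric_space) q \<le> dist (fst p) (fst q) + dist (snd p) (snd q)"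
  by (simp add: dist_prod_def sqrt_sum_squares_le_sum)

section \<open>Linearly many labels from monotone iterates\<close>

context horseshoe_skew
begin

text \<open>Tracks whether the composed fibre map along the first \<open>n\<close> symbols preserves
  order; equality of truth values acts as the product of signs.\<close>

fun orient :: "(int \<Rightarrow> nat) \<Rightarrow> nat \<Rightarrow> bool" where
  "orient \<omega> 0 = True"
| "orient \<omega> (Suc n) = (orient \<omega> n = mono_on {0..1} (f (\<omega> (int n))))"

lemma orient_cong: "\<forall>i<n. \<omega> (int i) = \<omega>' (int i) \<Longrightarrow> orient \<omega> n = orient \<omega>' n"
  by (induction n) auto

lemma iterates_ordered:
  assumes p: "p \<in> cylinder" and q: "q \<in> cylinder" and le: "snd p \<le> snd q"
    and "\<forall>i<n. w p (int i) = w q (int i)"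
  shows "if orient (w p) n then snd ((G ^^ n) p) \<le> snd ((G ^^ n) q) else snd ((G ^^ n) q) \<le> snd ((G ^^ n) p)"
  using assms(4)
proof (induction n)
  case 0
  then show ?case using le by simp
next
  case (Suc n)
  let ?i = "w p (int n)"
  have "fst p \<in> \<Gamma>" using p by auto
  then have "?i < 3" by (rule \<pi>_less)
  moreover have "w q (int n) = ?i" using Suc.prems by simp
  ultimately have i: "w q (int n) = ?i" "?i < 3" by blast+
  then have i: "w q (int n) = ?i" "?i < 3" using \<pi>_less Suc.prems by auto
  have rp: "snd ((G ^^ n) p) \<in> {0..1}" and rq: "snd ((G ^^ n) q) \<in> {0..1}"
    using p q snd_G_pow_range by blast+
  have IH: "if orient (w p) n then snd ((G ^^ n) p) \<le> snd ((G ^^ n) q) else snd ((G ^^ n) q) \<le> snd ((G ^^ n) p)"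
    using Suc by simp
  show ?case
  proof (cases "mono_on {0..1} (f ?i)")
    case True
    then show ?thesis
      using IH rp rq unfolding snd_G_Suc[OF p] snd_G_Suc[OF q] i(1)
      by (auto simp: mono_on_def monotone_on_def)
  next
    case False
    then have "antimono_on {0..1} (f ?i)" using monotone[OF i(2)] by blast
    then show ?thesis
      using False IH rp rq unfolding snd_G_Suc[OF p] snd_G_Suc[OF q] i(1)
      by (auto simp: monotone_on_def)
  qed
qed

text \<open>The index of the iterate on a grid of mesh \<open>1 / N\<close>, reflected when the
  composed map reverses order; it is thus nondecreasing in the initial coordinate. The end point 1
  has index \<open>N\<close>, so there are \<open>N + 1\<close> levels, and the subtraction
  \<open>N - m\<close> never truncates on the cylinder.\<close>

definition level :: "nat \<Rightarrow> nat \<Rightarrow> plane \<times> real \<Rightarrow> nat" where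
  "level N i p = (let m = nat \<lfloor>real N * snd ((G ^^ i) p)\<rfloor> in if orient (w p) i then m else N - m)"

lemma scaled_floor_le: assumes "p \<in> cylinder" shows "nat \<lfloor>real N * snd ((G ^^ i) p)\<rfloor> \<le> N"
proof -
  have "real N * snd ((G ^^ i) p) \<le> real N * 1"
    using snd_G_pow_range[OF assms, of i] by (intro mult_left_mono) auto
  then show ?thesis by linarith
qed

lemma level_le: "p \<in> cylinder \<Longrightarrow> level N i p \<le> N"
  using scaled_floor_le[of p N i] by (auto simp: level_def Let_def)

lemma level_mono:
  assumes p: "p \<in> cylinder" and q: "q \<in> cylinder" and le: "snd p \<le> snd q"
    and eq: "\<forall>j<i. w p (int j) = w q (int j)"
  shows "level N i p \<le> level N i q"
proof -
  have o: "orient (w q) i = orient (w p) i" using orient_cong[OF eq] by simp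
  have mono: "nat \<lfloor>real N * x\<rfloor> \<le> nat \<lfloor>real N * y\<rfloor>" if "x \<le> y" for x y :: real
    using that by (intro nat_mono floor_mono mult_left_mono) auto
  show ?thesis
    using iterates_ordered[OF p q le eq] mono unfolding level_def Let_def o
    by (auto intro: diff_le_mono2 split: if_splits)
qed

text \<open>All the levels are monotone in the initial fibre coordinate, so equality of their sums
  forces equality of every one of them.\<close>

lemma levels_determine_iterates:
  assumes p: "p \<in> cylinder" and q: "q \<in> cylinder" and le: "snd p \<le> snd q" and N: "N > 0"
    and eq: "\<forall>j<n. w p (int j) = w q (int j)"
    and sum: "(\<Sum>i<n. level N i p) = (\<Sum>i<n. level N i q)" and i: "i < n"
  shows "\<bar>snd ((G ^^ i) p) - snd ((G ^^ i) q)\<bar> < 1 / real N"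
proof -
  have mono: "level N j p \<le> level N j q" if "j < n" for j
    using eq that by (intro level_mono[OF p q le]) auto
  have "level N i p = level N i q"
  proof (rule ccontr)
    assume "level N i p \<noteq> level N i q"
    then have "level N i p < level N i q" using mono[OF i] by simp
    then have "(\<Sum>i<n. level N i p) < (\<Sum>i<n. level N i q)"
      using mono i by (intro sum_strict_mono_ex1) auto
    then show False using sum by simp
  qed
  moreover have "orient (w q) i = orient (w p) i" using eq i by (intro orient_cong) auto
  ultimately have "nat \<lfloor>real N * snd ((G ^^ i) p)\<rfloor> = nat \<lfloor>real N * snd ((G ^^ i) q)\<rfloor>"
    using scaled_floor_le[OF p, of N i] scaled_floor_le[OF q, of N i]
    by (auto simp: level_def Let_def split: if_splits)
  moreover have "0 \<le> \<lfloor>real N * snd ((G ^^ i) p)\<rfloor>" "0 \<le> \<lfloor>real N * snd ((G ^^ i) q)\<rfloor>"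
    using snd_G_pow_range[OF p, of i] snd_G_pow_range[OF q, of i] by auto
  ultimately have "\<lfloor>real N * snd ((G ^^ i) p)\<rfloor> = \<lfloor>real N * snd ((G ^^ i) q)\<rfloor>" by linarith
  then have "\<bar>real N * snd ((G ^^ i) p) - real N * snd ((G ^^ i) q)\<bar> < 1" by linarith
  then have "real N * \<bar>snd ((G ^^ i) p) - snd ((G ^^ i) q)\<bar> < 1"
    by (simp add: abs_mult right_diff_distrib[symmetric])
  then show ?thesis using N by (simp add: field_simps)
qed

lemma continuous_w: "continuous_on \<Lambda> (\<lambda>p. w p j)"
  by (rule continuous_on_compose2[OF continuous_\<pi>]) (use \<Lambda>_subset in \<open>auto intro: continuous_intros\<close>)

lemma measurable_w_coord [measurable]: "(\<lambda>p. w p j) \<in> measurable (restrict_space borel \<Lambda>) (count_space UNIV)"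
  using borel_measurable_continuous_on_restrict[OF continuous_w[of j]]
    measurable_cong_sets[OF refl sets_borel_eq_count_space] by blast

lemma measurable_level [measurable]: "level N i \<in> measurable (restrict_space borel \<Lambda>) (count_space UNIV)"
proof -
  have snd: "(\<lambda>p. snd ((G ^^ i) p)) \<in> borel_measurable (restrict_space borel \<Lambda>)"
    by (intro borel_measurable_continuous_on_restrict continuous_on_snd
        continuous_on_subset[OF continuous_G_pow] \<Lambda>_subset)
  have orient: "Measurable.pred (restrict_space borel \<Lambda>) (\<lambda>p. orient (w p) n)" for n
  proof (induction n)
    case (Suc n)
    have "(\<lambda>p. mono_on {0..1} (f (w p (int n)))) \<in> measurable (restrict_space borel \<Lambda>) (count_space UNIV)"
      by (rule measurable_compose[OF measurable_w_coord]) simp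
    then show ?case using Suc by simp
  qed simp
  have "(\<lambda>x. nat \<lfloor>real N * x\<rfloor>) \<in> measurable borel (count_space UNIV)" by measurable
  from measurable_compose[OF snd this]
  have m: "(\<lambda>p. nat \<lfloor>real N * snd ((G ^^ i) p)\<rfloor>) \<in> measurable (restrict_space borel \<Lambda>) (count_space UNIV)" .
  then have m': "(\<lambda>p. N - nat \<lfloor>real N * snd ((G ^^ i) p)\<rfloor>) \<in> measurable (restrict_space borel \<Lambda>) (count_space UNIV)"
    by (rule measurable_compose) simp
  show ?thesis unfolding level_def Let_def by (rule measurable_If[OF m m' orient[of i, unfolded pred_def]])
qed

text \<open>The label is the sum of the levels, at most \<open>n * N\<close>. Half of
  \<open>e\<close> is spent in the base and half in the fibre: the overhang \<open>k\<close> keeps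
  base points close at all times \<open>i < n\<close>, and the mesh \<open>1 / N\<close> keeps the
  fibre coordinates close.\<close>

lemma cells:
  assumes "e > 0"
  shows "\<exists>k N S. \<forall>n. (\<forall>p\<in>\<Lambda>. S n p \<le> n * N) \<and>
      S n \<in> measurable (restrict_space borel \<Lambda>) (count_space UNIV) \<and>
      (\<forall>p\<in>\<Lambda>. \<forall>q\<in>\<Lambda>. word (w p) (- int k) (n + 2 * k) = word (w q) (- int k) (n + 2 * k) \<and>
         S n p = (S n q :: nat) \<longrightarrow> (\<forall>i<n. dist ((G ^^ i) p) ((G ^^ i) q) < e))"
proof -
  have e2: "e / 2 > 0" using assms by simp
  obtain k :: nat where k: "\<forall>X\<in>\<Gamma>. \<forall>Y\<in>\<Gamma>. (\<forall>j. \<bar>j\<bar> \<le> int k \<longrightarrow> \<pi> X j = \<pi> Y j) \<longrightarrow> dist X Y < e / 2"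
    using cylinders_shrink[OF e2] by blast
  obtain N' :: nat where N': "1 / real (Suc N') < e / 2" using nat_approx_posE[OF e2] by blast
  define N where "N = Suc N'"
  define S where "S n p = (\<Sum>i<n. level N i p)" for n p
  have "(\<forall>p\<in>\<Lambda>. S n p \<le> n * N) \<and> S n \<in> measurable (restrict_space borel \<Lambda>) (count_space UNIV) \<and>
      (\<forall>p\<in>\<Lambda>. \<forall>q\<in>\<Lambda>. word (w p) (- int k) (n + 2 * k) = word (w q) (- int k) (n + 2 * k) \<and>
         S n p = S n q \<longrightarrow> (\<forall>i<n. dist ((G ^^ i) p) ((G ^^ i) q) < e))" for n
  proof (intro conjI ballI allI impI)
    fix p assume "p \<in> \<Lambda>"
    then have "p \<in> cylinder" using \<Lambda>_subset by blast
    then have "S n p \<le> (\<Sum>i<n. N)" unfolding S_def by (intro sum_mono level_le)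
    then show "S n p \<le> n * N" by simp
  next
    show "S n \<in> measurable (restrict_space borel \<Lambda>) (count_space UNIV)"
      unfolding S_def by measurable
  next
    fix p q i
    assume pq: "p \<in> \<Lambda>" "q \<in> \<Lambda>"
      and *: "word (w p) (- int k) (n + 2 * k) = word (w q) (- int k) (n + 2 * k) \<and> S n p = S n q"
      and i: "i < n"
    have K: "p \<in> cylinder" "q \<in> cylinder" using pq \<Lambda>_subset by auto
    have sym: "w p j = w q j" if "- int k \<le> j" "j < int n + int k" for j
      using * that unfolding word_eq_iff by auto
    have "dist (fst ((G ^^ i) p)) (fst ((G ^^ i) q)) < e / 2"
    proof -
      have \<Gamma>: "fst p \<in> \<Gamma>" "fst q \<in> \<Gamma>" using K by auto
      have "\<pi> ((\<Phi> ^^ i) (fst p)) j = \<pi> ((\<Phi> ^^ i) (fst q)) j" if "\<bar>j\<bar> \<le> int k" for j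
        using \<pi>_\<Phi>_pow \<Gamma> sym[of "j + int i"] that i by auto
      then show ?thesis using k \<pi>_\<Phi>_pow \<Gamma> by (simp add: fst_G_pow)
    qed
    moreover have "\<bar>snd ((G ^^ i) p) - snd ((G ^^ i) q)\<bar> < 1 / real N"
    proof (cases "snd p \<le> snd q")
      case True
      then show ?thesis
        using sym * i K by (intro levels_determine_iterates[where n=n]) (auto simp: N_def S_def)
    next
      case False
      then have "\<bar>snd ((G ^^ i) q) - snd ((G ^^ i) p)\<bar> < 1 / real N"
        using sym * i K by (intro levels_determine_iterates[where n=n]) (auto simp: N_def S_def)
      then show ?thesis by (simp add: abs_minus_commute)
    qed
    ultimately show "dist ((G ^^ i) p) ((G ^^ i) q) < e"
      using dist_prod_le[of "(G ^^ i) p" "(G ^^ i) q"] N' by (simp add: dist_real_def N_def)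
  qed
  then show ?thesis by (intro exI[of _ k] exI[of _ N] exI[of _ S] allI)
qed

sublocale shift_extension G \<Lambda> w
proof
  show "full_shift_space \<subseteq> w ` \<Lambda>"
  proof
    fix \<omega> assume \<omega>: "\<omega> \<in> full_shift_space"
    then obtain p where "p \<in> \<Lambda>" "fst p = decode \<omega>" using decode_into fst_\<Lambda> by (metis imageE)
    then show "\<omega> \<in> w ` \<Lambda>" using \<pi>_decode[OF \<omega>] by force
  qed
  show "w p \<in> full_shift_space" if "p \<in> \<Lambda>" for p using \<pi>_into that \<Lambda>_subset by auto
  show "w (G p) = shift (w p)" if "p \<in> \<Lambda>" for p using \<pi>_\<Phi> that \<Lambda>_subset by (auto simp: fst_G)
qed (auto intro: compact_\<Lambda> G_into continuous_w cells)


subsection \<open>The invariant graph\<close>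

text \<open>A selector defined on all fibres is needed although almost every fibre is one point; the
  largest point is a choice whose measurability follows from compactness of
  \<open>\<Lambda>\<close>.\<close>

definition section_top :: "plane \<Rightarrow> real" where
  "section_top X = Sup {x. (X, x) \<in> \<Lambda>}"

lemma section_compact: "compact {x. (X, x) \<in> \<Lambda>}"
proof -
  have "{x. (X, x) \<in> \<Lambda>} = snd ` (\<Lambda> \<inter> {X} \<times> UNIV)" by force
  moreover have "compact (\<Lambda> \<inter> {X} \<times> UNIV)"
    by (rule compact_Int_closed[OF compact_\<Lambda> closed_Times[OF closed_singleton closed_UNIV]])
  then have "compact (snd ` (\<Lambda> \<inter> {X} \<times> UNIV))"
    by (rule compact_continuous_image[OF continuous_on_snd[OF continuous_on_id]])
  ultimately show ?thesis by (simp only:)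
qed

lemma section_nonempty: "X \<in> \<Gamma> \<Longrightarrow> {x. (X, x) \<in> \<Lambda>} \<noteq> {}"
  unfolding fst_\<Lambda>[symmetric] by auto

lemma section_top_in: "X \<in> \<Gamma> \<Longrightarrow> (X, section_top X) \<in> \<Lambda>"
  using closed_contains_Sup[OF section_nonempty _ compact_imp_closed[OF section_compact], of X]
    bounded_imp_bdd_above[OF compact_imp_bounded[OF section_compact]]
  by (auto simp: section_top_def)

lemma section_top_ge: "(X, x) \<in> \<Lambda> \<Longrightarrow> x \<le> section_top X"
  unfolding section_top_def
  by (intro cSup_upper bounded_imp_bdd_above compact_imp_bounded section_compact) simp

text \<open>The top of a compact set over its base is upper semicontinuous.\<close>

lemma measurable_section_top: "section_top \<in> borel_measurable (restrict_space borel \<Gamma>)"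
  unfolding borel_measurable_iff_ge
proof
  fix c
  let ?C = "fst ` (\<Lambda> \<inter> UNIV \<times> {c..})"
  have "{X \<in> \<Gamma>. c \<le> section_top X} = ?C"
  proof (intro equalityI subsetI)
    fix X assume "X \<in> {X \<in> \<Gamma>. c \<le> section_top X}"
    then show "X \<in> ?C" using section_top_in[of X] by (intro image_eqI[of _ _ "(X, section_top X)"]) auto
  next
    fix X assume "X \<in> ?C"
    then obtain x where x: "(X, x) \<in> \<Lambda>" "c \<le> x" by auto
    then show "X \<in> {X \<in> \<Gamma>. c \<le> section_top X}" using section_top_ge[OF x(1)] \<Lambda>_subset by auto
  qed
  moreover have "compact ?C"
    by (rule compact_continuous_image[OF continuous_on_fst[OF continuous_on_id]
          compact_Int_closed[OF compact_\<Lambda> closed_Times[OF closed_UNIV closed_atLeast]]])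
  then have "?C \<in> sets borel" by (rule borel_compact)
  moreover have "\<Gamma> \<in> sets borel" using compact_\<Gamma> by (rule borel_compact)
  ultimately show "{X \<in> space (restrict_space borel \<Gamma>). c \<le> section_top X} \<in> sets (restrict_space borel \<Gamma>)"
    by (auto simp: space_restrict_space sets_restrict_space_iff)
qed

definition graph :: "(int \<Rightarrow> nat) \<Rightarrow> plane \<times> real" where
  "graph \<omega> = (decode \<omega>, section_top (decode \<omega>))"

lemma graph_in: "\<omega> \<in> full_shift_space \<Longrightarrow> graph \<omega> \<in> \<Lambda>"
  by (simp add: graph_def section_top_in decode_into)

lemma w_graph: "\<omega> \<in> full_shift_space \<Longrightarrow> w (graph \<omega>) = \<omega>"
  by (simp add: graph_def \<pi>_decode)

text \<open>\<open>bernoulli\<close> carries the product sigma-algebra while \<open>decode\<close>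
  is Borel by continuity; measurability of the coordinates links the two.\<close>

lemma measurable_decode: "decode \<in> measurable bernoulli (restrict_space borel \<Gamma>)"
proof -
  have "(\<lambda>\<omega>. \<omega> :: int \<Rightarrow> nat) \<in> borel_measurable bernoulli"
  proof (rule measurable_coordinatewise_then_product)
    show "(\<lambda>\<omega>. \<omega> j) \<in> borel_measurable bernoulli" for j
      using measurable_bernoulli_coord[of j] measurable_cong_sets[OF refl sets_borel_eq_count_space] by blast
  qed
  then have "(\<lambda>\<omega>. \<omega>) \<in> measurable bernoulli (restrict_space borel full_shift_space)"
    by (intro measurable_restrict_space2) (auto simp: space_bernoulli)
  moreover have "decode \<in> borel_measurable (restrict_space borel full_shift_space)"
    using homeo by (intro borel_measurable_continuous_on_restrict) (simp add: homeomorphism_def)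
  ultimately have "decode \<in> borel_measurable bernoulli" by (rule measurable_compose)
  then show ?thesis by (intro measurable_restrict_space2) (auto simp: space_bernoulli decode_into)
qed

lemma measurable_graph: "graph \<in> measurable bernoulli (restrict_space borel \<Lambda>)"
proof (rule measurable_restrict_space2)
  show "graph \<in> space bernoulli \<rightarrow> \<Lambda>" by (auto simp: space_bernoulli graph_in)
  have "decode \<in> borel_measurable bernoulli"
    using measurable_decode measurable_restrict_space2_iff by blast
  then show "graph \<in> borel_measurable bernoulli"
    unfolding graph_def
    by (intro borel_measurable_Pair measurable_compose[OF measurable_decode measurable_section_top])
qed

text \<open>Where the past products become arbitrarily small, \<open>fiber_contraction\<close>
  leaves distance 0. The statement is about sequences rather than points, so that it can be pulled
  back along the shift and along any uniform coding.\<close>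

lemma AE_graph: "AE \<omega> in bernoulli. \<forall>p\<in>\<Lambda>. w p = \<omega> \<longrightarrow> p = graph \<omega>"
proof -
  have "AE \<omega> in bernoulli. \<forall>c>0. \<exists>n. prod_list (map b (word \<omega> (- int n) n)) < c"
    by (rule AE_backward_products_small[OF uniform_coding_bernoulli b_pos contraction])
  then show ?thesis using AE_space
  proof eventually_elim
    case (elim \<omega>)
    have \<omega>: "\<omega> \<in> full_shift_space" using elim by (simp add: space_bernoulli)
    show ?case
    proof (intro ballI impI)
      fix p assume p: "p \<in> \<Lambda>" "w p = \<omega>"
      then have fst: "fst p = fst (graph \<omega>)" using decode_\<pi> \<Lambda>_subset by (auto simp: graph_def)
      have "\<bar>snd p - snd (graph \<omega>)\<bar> \<le> prod_list (map b (word \<omega> (- int n) n))" for n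
        using fiber_contraction[OF p(1) graph_in[OF \<omega>] fst, of n] p(2) by simp
      then have "\<not> \<bar>snd p - snd (graph \<omega>)\<bar> > 0" using elim(1) by (meson not_less)
      then show "p = graph \<omega>" using fst by (auto simp: prod_eq_iff)
    qed
  qed
qed

section \<open>The lift of the Bernoulli measure\<close>

definition graph_measure :: "(plane \<times> real) measure" where
  "graph_measure = distr bernoulli (restrict_space borel \<Lambda>) graph"

lemma sets_graph_measure: "sets graph_measure = sets (restrict_space borel \<Lambda>)"
  and space_graph_measure: "space graph_measure = \<Lambda>"
  by (simp_all add: graph_measure_def space_restrict_space)

lemma prob_space_graph_measure: "prob_space graph_measure"
  unfolding graph_measure_def
  using uniform_coding_bernoulli by (intro prob_space.prob_space_distr measurable_graph) (simp add: uniform_coding_def)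

lemma measurable_G: "G \<in> measurable (restrict_space borel \<Lambda>) (restrict_space borel \<Lambda>)"
  by (intro measurable_restrict_space2 borel_measurable_continuous_on_restrict
      continuous_on_subset[OF continuous_G \<Lambda>_subset])
    (auto simp: space_restrict_space G_into)

lemma measurable_shift: "shift \<in> measurable bernoulli bernoulli"
  by (rule measurable_uniform_coding[OF uniform_coding_shift[OF uniform_coding_bernoulli]])

text \<open>The graph need not be invariant everywhere, since an order-reversing fibre map sends a
  top to a bottom. But \<open>G (graph \<omega>)\<close> is a point of \<open>\<Lambda>\<close>
  coded by \<open>shift \<omega>\<close>, hence equals \<open>graph (shift \<omega>)\<close> for
  almost every \<open>\<omega>\<close>, and shift invariance carries over.\<close>

lemma invariant_graph_measure: "invariant_borel_probability G \<Lambda> graph_measure"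
  unfolding invariant_borel_probability_def
proof (intro conjI prob_space_graph_measure space_graph_measure sets_graph_measure)
  show "G \<in> measurable graph_measure graph_measure"
    using measurable_G by (simp add: measurable_cong_sets[OF sets_graph_measure sets_graph_measure])
  \<comment> \<open>Uniqueness is needed over \<open>shift \<omega>\<close>; the shift preserves
    \<open>bernoulli\<close>, so the exceptional set pulls back to a null set.\<close>
  have "AE \<omega> in distr bernoulli bernoulli shift. \<forall>p\<in>\<Lambda>. w p = \<omega> \<longrightarrow> p = graph \<omega>"
    unfolding distr_bernoulli_shift by (rule AE_graph)
  then have AE: "AE \<omega> in bernoulli. \<forall>p\<in>\<Lambda>. w p = shift \<omega> \<longrightarrow> p = graph (shift \<omega>)"
    by (rule AE_distrD[OF measurable_shift])
  have "distr graph_measure graph_measure G = distr graph_measure (restrict_space borel \<Lambda>) G"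
    by (intro distr_cong sets_graph_measure) auto
  also have "\<dots> = distr bernoulli (restrict_space borel \<Lambda>) (G \<circ> graph)"
    unfolding graph_measure_def by (rule distr_distr[OF measurable_G measurable_graph])
  also have "\<dots> = distr bernoulli (restrict_space borel \<Lambda>) (graph \<circ> shift)"
  proof (rule distr_cong_AE)
    show "AE \<omega> in bernoulli. (G \<circ> graph) \<omega> = (graph \<circ> shift) \<omega>"
      using AE AE_space
    proof eventually_elim
      case (elim \<omega>)
      then have \<omega>: "\<omega> \<in> full_shift_space" by (simp add: space_bernoulli)
      have "G (graph \<omega>) \<in> \<Lambda>" by (rule G_into[OF graph_in[OF \<omega>]])
      moreover have "w (G (graph \<omega>)) = shift \<omega>" using w_T[OF graph_in[OF \<omega>]] w_graph[OF \<omega>] by simp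
      ultimately show ?case using elim(1) by simp
    qed
  qed (auto intro: measurable_comp measurable_graph measurable_G measurable_shift)
  also have "\<dots> = distr (distr bernoulli bernoulli shift) (restrict_space borel \<Lambda>) graph"
    by (rule distr_distr[OF measurable_graph measurable_shift, symmetric])
  also have "\<dots> = graph_measure" by (simp add: distr_bernoulli_shift graph_measure_def)
  finally show "distr graph_measure graph_measure G = graph_measure" .
qed

lemma uniform_coding_graph_measure: "uniform_coding graph_measure w"
  unfolding uniform_coding_def
proof (intro conjI allI ballI prob_space_graph_measure)
  show meas: "(\<lambda>p. w p j) \<in> measurable graph_measure (count_space UNIV)" for j
    using measurable_w_coord by (simp add: measurable_cong_sets[OF sets_graph_measure refl])
  show "w p \<in> full_shift_space" if "p \<in> space graph_measure" for p
    using that w_into by (simp add: space_graph_measure)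
  fix a n v assume v: "v \<in> words n"
  have ev: "{p \<in> space graph_measure. word (w p) a n = v} \<in> sets graph_measure"
  proof -
    have [measurable]: "(\<lambda>p. w p j) \<in> measurable graph_measure (count_space UNIV)" for j by (rule meas)
    show ?thesis unfolding word_eq_list_iff by measurable
  qed
  have "graph -` {p \<in> space graph_measure. word (w p) a n = v} \<inter> space bernoulli =
      {\<omega> \<in> space bernoulli. word \<omega> a n = v}"
    by (auto simp: space_bernoulli space_graph_measure graph_in w_graph)
  then have "measure graph_measure {p \<in> space graph_measure. word (w p) a n = v} =
      measure bernoulli {\<omega> \<in> space bernoulli. word \<omega> a n = v}"
    using measure_distr[OF measurable_graph, of "{p \<in> space graph_measure. word (w p) a n = v}"] ev
    by (simp add: graph_measure_def)
  also have "\<dots> = 1 / 3 ^ n" using uniform_coding_bernoulli v by (simp add: uniform_coding_def)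
  finally show "measure graph_measure {p \<in> space graph_measure. word (w p) a n = v} = 1 / 3 ^ n" .
qed

text \<open>The coding sends \<open>M\<close> to \<open>bernoulli\<close>, so
  \<open>M\<close>-almost every point is the only one over its base point. There
  \<open>graph \<circ> w\<close> is the identity, and \<open>M\<close> is recovered from its own
  coding.\<close>

lemma uniform_coding_imp_graph_measure:
  assumes inv: "invariant_borel_probability G \<Lambda> M" and U: "uniform_coding M w"
  shows "M = graph_measure"
proof -
  have M: "space M = \<Lambda>" "sets M = sets (restrict_space borel \<Lambda>)"
    using inv by (simp_all add: invariant_borel_probability_def)
  note w = measurable_uniform_coding[OF U]
  have "AE \<omega> in distr M bernoulli w. \<forall>p\<in>\<Lambda>. w p = \<omega> \<longrightarrow> p = graph \<omega>"
    unfolding distr_uniform_coding[OF U] by (rule AE_graph)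
  then have AE: "AE q in M. \<forall>p\<in>\<Lambda>. w p = w q \<longrightarrow> p = graph (w q)"
    by (rule AE_distrD[OF w])
  have "graph_measure = distr (distr M bernoulli w) (restrict_space borel \<Lambda>) graph"
    by (simp only: graph_measure_def distr_uniform_coding[OF U])
  also have "\<dots> = distr M (restrict_space borel \<Lambda>) (graph \<circ> w)"
    by (rule distr_distr[OF measurable_graph w])
  also have "\<dots> = distr M (restrict_space borel \<Lambda>) (\<lambda>p. p)"
  proof (rule distr_cong_AE)
    show "AE p in M. (graph \<circ> w) p = p"
      using AE AE_space by eventually_elim (simp add: M)
    show "(\<lambda>p. p) \<in> measurable M (restrict_space borel \<Lambda>)"
      by (rule measurable_ident_sets[OF M(2)])
  qed (auto intro: measurable_comp[OF w measurable_graph])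
  also have "\<dots> = M" by (rule distr_id2[OF M(2)[symmetric]])
  finally show ?thesis by simp
qed

theorem maximal_entropy_iff_graph_measure:
  "measure_of_maximal_entropy G \<Lambda> M \<longleftrightarrow> M = graph_measure"
  unfolding measure_of_maximal_entropy_iff
  using uniform_coding_imp_graph_measure invariant_graph_measure uniform_coding_graph_measure by blast

section \<open>The central Lyapunov exponent\<close>

lemma central_derivative_norm_eq:
  assumes "p \<in> cylinder"
  shows "central_derivative_norm G p = \<bar>df (w p 0) (snd p)\<bar>"
proof -
  obtain X x where p: "p = (X, x)" by (cases p)
  have X: "X \<in> \<Gamma>" "x \<in> {0..1}" using assms p by auto
  have "((\<lambda>t. (\<Phi> X, f (\<pi> X 0) t)) has_vector_derivative (0, df (\<pi> X 0) x)) (at x within {0..1})"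
    using f_deriv[OF \<pi>_less[OF X(1)] X(2)]
    by (intro has_vector_derivative_Pair has_vector_derivative_const)
      (simp add: has_real_derivative_iff_has_vector_derivative)
  then have "vector_derivative (\<lambda>t. (\<Phi> X, f (\<pi> X 0) t)) (at x within {0..1}) = (0, df (\<pi> X 0) x)"
    using X(2) vector_derivative_within_cbox[of 0 1 x] by (simp only: cbox_interval) simp
  then show ?thesis using X(1) by (simp add: central_derivative_norm_def p G_eq norm_Pair)
qed

text \<open>The integrand \<open>h\<close> is dominated by \<open>u\<close>, which depends only on
  the zeroth symbol. All three symbols have probability \<open>1 / 3\<close>, so the integral of
  \<open>u\<close> is a third of the logarithm of the product of the bounds.\<close>

lemma central_exponent_negative: "central_lyapunov_exponent G graph_measure < 0"
proof -
  interpret M: prob_space graph_measure by (rule prob_space_graph_measure)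
  define h where "h p = ln \<bar>df (w p 0) (snd p)\<bar>" for p
  define u where "u p = (\<Sum>i<3. ln (b i) * indicator {p \<in> \<Lambda>. w p 0 = i} p)" for p :: "plane \<times> real"
  have \<Lambda>D: "w p 0 < 3" "snd p \<in> {0..1}" if "p \<in> \<Lambda>" for p
    using that \<Lambda>_subset \<pi>_less by auto
  have cont: "continuous_on \<Lambda> h"
  proof -
    have sym: "continuous_on \<Lambda> (\<lambda>p. of_bool (w p 0 = i) :: real)" for i
      by (rule continuous_on_compose2[of UNIV "\<lambda>j. of_bool (j = i)", OF _ continuous_w]) auto
    have fib: "continuous_on \<Lambda> (\<lambda>p. ln \<bar>df i (snd p)\<bar>)" if i: "i < 3" for i
    proof -
      have "continuous_on \<Lambda> (\<lambda>p. df i (snd p))"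
        by (rule continuous_on_compose2[OF df_continuous[OF i] continuous_on_snd[OF continuous_on_id]])
          (use \<Lambda>D in auto)
      then have "continuous_on \<Lambda> (\<lambda>p. \<bar>df i (snd p)\<bar>)" by (rule continuous_on_rabs)
      then show ?thesis
        by (rule continuous_on_ln) (use df_nonzero[OF i] \<Lambda>D in auto)
    qed
    have "continuous_on \<Lambda> (\<lambda>p. \<Sum>i<3. of_bool (w p 0 = i) * ln \<bar>df i (snd p)\<bar>)"
      by (intro continuous_on_sum continuous_on_mult sym fib) simp
    moreover have "(\<Sum>i<3. of_bool (w p 0 = i) * ln \<bar>df i (snd p)\<bar>) = h p" if "p \<in> \<Lambda>" for p
    proof -
      have "(\<Sum>i<3. of_bool (w p 0 = i) * ln \<bar>df i (snd p)\<bar>) = (\<Sum>i<3. if i = w p 0 then ln \<bar>df i (snd p)\<bar> else 0)"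
        by (intro sum.cong) auto
      also have "\<dots> = h p" using \<Lambda>D(1)[OF that] by (simp add: h_def)
      finally show ?thesis .
    qed
    ultimately show ?thesis by (simp cong: continuous_on_cong)
  qed
  have hM: "h \<in> borel_measurable graph_measure"
    using borel_measurable_continuous_on_restrict[OF cont]
    by (simp add: measurable_cong_sets[OF sets_graph_measure refl])
  \<comment> \<open>Integrability has substance here: a nonintegrable function has integral 0 by
    convention, which would not be negative.\<close>
  have "bounded (h ` \<Lambda>)"
    by (rule compact_imp_bounded[OF compact_continuous_image[OF cont compact_\<Lambda>]])
  then obtain B where "\<forall>p\<in>\<Lambda>. norm (h p) \<le> B" unfolding bounded_iff by auto
  then have int_h: "integrable graph_measure h"
    by (intro M.integrable_const_bound[of _ B] AE_I2 hM) (simp add: space_graph_measure)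
  have evs: "{p \<in> \<Lambda>. w p 0 = i} \<in> sets graph_measure" for i
    using measure_uniform_coding(2)[OF uniform_coding_graph_measure, of "\<lambda>v. v = [i]" 0 1]
    by (simp add: word_def space_graph_measure)
  have prob: "M.prob {p \<in> \<Lambda>. w p 0 = i} = 1 / 3" if "i < 3" for i
  proof -
    have "[i] \<in> words 1" using that by (simp add: words_def)
    then have "M.prob {p \<in> space graph_measure. word (w p) 0 1 = [i]} = 1 / 3 ^ 1"
      using uniform_coding_graph_measure unfolding uniform_coding_def by blast
    then show ?thesis by (simp add: word_def space_graph_measure)
  qed
  have int_u: "integrable graph_measure u"
    unfolding u_def
    by (intro Bochner_Integration.integrable_sum integrable_mult_right integrable_real_indicator evs)
      (simp add: M.emeasure_eq_measure)
  have "integral\<^sup>L graph_measure u = (\<Sum>i<3. ln (b i) * M.prob {p \<in> \<Lambda>. w p 0 = i})"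
    unfolding u_def using evs
    by (subst Bochner_Integration.integral_sum)
      (auto intro!: integrable_mult_right integrable_real_indicator simp: M.emeasure_eq_measure)
  also have "\<dots> = (\<Sum>i<3. ln (b i) * (1 / 3))" using prob by (intro sum.cong) auto
  also have "\<dots> = (\<Sum>i<3. ln (b i)) * (1 / 3)" by (rule sum_distrib_right[symmetric])
  also have "(\<Sum>i<3. ln (b i)) = ln (\<Prod>i<3. b i)"
    using b_pos by (subst ln_prod) (force, simp)+
  also have "\<dots> * (1 / 3) < 0"
  proof -
    have "(\<Prod>i<3. b i) > 0" using b_pos by (intro prod_pos) simp
    then show ?thesis using contraction by simp
  qed
  finally have neg: "integral\<^sup>L graph_measure u < 0" .
  have "h p \<le> u p" if p: "p \<in> \<Lambda>" for p
  proof -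
    have "u p = (\<Sum>i<3. if i = w p 0 then ln (b i) else 0)"
      unfolding u_def using p by (intro sum.cong) (auto simp: indicator_def)
    also have "\<dots> = ln (b (w p 0))" using \<Lambda>D(1)[OF p] by simp
    finally have u: "u p = ln (b (w p 0))" .
    show ?thesis
      unfolding u h_def using df_bound[OF \<Lambda>D[OF p]] df_nonzero[OF \<Lambda>D[OF p]] by (intro ln_mono) auto
  qed
  then have "integral\<^sup>L graph_measure h \<le> integral\<^sup>L graph_measure u"
    by (intro integral_mono int_h int_u) (simp add: space_graph_measure)
  moreover have "central_lyapunov_exponent G graph_measure = integral\<^sup>L graph_measure h"
    unfolding central_lyapunov_exponent_def h_def
  proof (rule Bochner_Integration.integral_cong[OF refl])
    fix p assume "p \<in> space graph_measure"
    then have "p \<in> cylinder" using \<Lambda>_subset by (auto simp only: space_graph_measure)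
    then show "ln (central_derivative_norm G p) = ln \<bar>df (w p 0) (snd p)\<bar>"
      by (simp only: central_derivative_norm_eq)
  qed
  ultimately show ?thesis using neg by simp
qed

end

text \<open>Derivatives are one-sided at the end points, so a negative value is refuted by a nearby
  point on the right, or on the left when \<open>x = 1\<close>.\<close>

lemma mono_on_interval_imp_derivative_nonneg:
  fixes g :: "real \<Rightarrow> real"
  assumes mono: "mono_on {0..1} g" and x: "x \<in> {0..1}"
    and deriv: "(g has_real_derivative d) (at x within {0..1})"
  shows "d \<ge> 0"
proof (rule ccontr)
  assume "\<not> d \<ge> 0"
  then have d: "d < 0" by simp
  show False
  proof (cases "x < 1")
    case True
    obtain e where e: "e > 0" "\<And>h. h > 0 \<Longrightarrow> x + h \<in> {0..1} \<Longrightarrow> h < e \<Longrightarrow> g (x + h) < g x"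
      using has_real_derivative_neg_dec_right[OF deriv d] by blast
    define h where "h = min (e / 2) (1 - x)"
    have h: "h > 0" "x + h \<in> {0..1}" "h < e" using True x e(1) by (auto simp: h_def)
    have "g x \<le> g (x + h)" using mono_onD[OF mono x h(2)] h(1) by simp
    then show False using e(2)[OF h] by simp
  next
    case False
    then have x1: "x = 1" using x by simp
    obtain e where e: "e > 0" "\<And>h. h > 0 \<Longrightarrow> x - h \<in> {0..1} \<Longrightarrow> h < e \<Longrightarrow> g x < g (x - h)"
      using has_real_derivative_neg_dec_left[OF deriv d] by blast
    define h where "h = min (e / 2) 1"
    have h: "h > 0" "x - h \<in> {0..1}" "h < e" using x1 e(1) by (auto simp: h_def)
    have "g (x - h) \<le> g x" using mono_onD[OF mono h(2) x] h(1) by simp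
    then show False using e(2)[OF h] by simp
  qed
qed

section \<open>Checking the abstract conditions for the given fibre maps\<close>

theorem corollary5p12:
  fixes \<Phi> :: "plane \<Rightarrow> plane" and R :: "nat \<Rightarrow> plane set" and \<Gamma> :: "plane set"
    and \<pi> :: "plane \<Rightarrow> int \<Rightarrow> nat" and cs ex :: "nat \<Rightarrow> real"
    and f df :: "nat \<Rightarrow> real \<Rightarrow> real" and \<gamma> :: real
    and F :: "plane \<times> real \<Rightarrow> plane \<times> real" and \<Lambda> :: "(plane \<times> real) set"
  assumes "three_legged_horseshoe \<Phi> R \<Gamma> \<pi> cs ex"
    and "C1_fiber_maps f df"
    and "dominated_fibers cs ex df"
    and "F = skew_product \<Phi> R f"
    and "\<Lambda> = maximal_invariant_set F (skew_domain R)"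
    and "cond_F0 f df"
    and "cond_F1 f df \<gamma>"
    and "cond_F2 f df"
    and "cond_F01 df \<gamma>"
    and "cond_F012 f df \<gamma>"
    and "\<gamma> * (beta_max df)\<^sup>2 < 1"
  shows "(\<exists>!\<mu>. measure_of_maximal_entropy F \<Lambda> \<mu>) \<and>
         (\<forall>\<mu>. measure_of_maximal_entropy F \<Lambda> \<mu> \<longrightarrow> central_lyapunov_exponent F \<mu> < 0)"
proof -
  have three: "i < 3 \<longleftrightarrow> i = 0 \<or> i = 1 \<or> i = (2::nat)" for i by auto
  have \<gamma>: "\<gamma> > 0" using assms(6,7) by (auto simp: cond_F0_def cond_F1_def)
  have f1: "f 1 x = \<gamma> * (1 - x)" if "x \<in> {0..1}" for x using assms(7) that by (auto simp: cond_F1_def)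
  have mono: "mono_on {0..1} (f 0)" "mono_on {0..1} (f 2)"
    using assms(6,8) by (auto simp: cond_F0_def cond_F2_def intro: strict_mono_on_imp_mono_on)
  have deriv: "(f i has_real_derivative df i x) (at x within {0..1})" if "i < 3" "x \<in> {0..1}" for i x
    using assms(2) that by (auto simp: C1_fiber_maps_def)
  have df1: "df 1 x = - \<gamma>" if x: "x \<in> {0..1}" for x
  \<comment> \<open>The formula for \<open>f 1\<close> is known on the unit interval only, so
    \<open>df 1\<close> is identified by uniqueness of the derivative within a closed interval, end
    points included.\<close>
  proof -
    have "((\<lambda>x. \<gamma> * (1 - x)) has_real_derivative - \<gamma>) (at x within {0..1})"
      by (auto intro!: derivative_eq_intros)
    then have "(f 1 has_real_derivative - \<gamma>) (at x within {0..1})"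
      by (rule has_field_derivative_transform_within[OF _ zero_less_one x]) (use f1 in auto)
    then have "(f 1 has_vector_derivative - \<gamma>) (at x within cbox 0 1)"
      "(f 1 has_vector_derivative df 1 x) (at x within cbox 0 1)"
      using deriv[of 1 x] x by (simp_all add: has_real_derivative_iff_has_vector_derivative cbox_interval)
    then show ?thesis using vector_derivative_unique_within_closed_interval[of 0 1 x "f 1"] x
      by (auto simp: cbox_interval)
  qed
  \<comment> \<open>Symbols 0 and 2 share the bound \<open>beta_max df\<close> and symbol 1 gets its
    exact rate, so \<open>contraction\<close> becomes the numerical hypothesis of the
    theorem.\<close>
  interpret horseshoe_skew \<Phi> R \<Gamma> \<pi> cs ex f df "\<lambda>i. if i = 1 then \<gamma> else beta_max df"
  proof
    show "three_legged_horseshoe \<Phi> R \<Gamma> \<pi> cs ex" "C1_fiber_maps f df" by fact+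
    fix i :: nat assume i: "i < 3"
    have "antimono_on {0..1} (f 1)"
      using \<gamma> f1 by (auto simp: monotone_on_def)
    then show "mono_on {0..1} (f i) \<or> antimono_on {0..1} (f i)" using mono i by (auto simp: three)
    fix x :: real assume x: "x \<in> {0..1}"
    \<comment> \<open>Monotonicity alone gives only a weak sign; domination of the strong
      contraction rate excludes a zero of the fibre derivative.\<close>
    have "\<bar>cs i\<bar> < \<bar>df i x\<bar>" using assms(3) i x unfolding dominated_fibers_def by blast
    then show "df i x \<noteq> 0" by auto
    have "df 0 x \<le> beta_max df" "df 2 x \<le> beta_max df"
      using assms(10) x by (auto simp: cond_F012_def)
    moreover have "df 0 x \<ge> 0" "df 2 x \<ge> 0"
      using mono_on_interval_imp_derivative_nonneg[OF mono(1) x deriv[OF _ x]]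
        mono_on_interval_imp_derivative_nonneg[OF mono(2) x deriv[OF _ x]] by auto
    ultimately show "\<bar>df i x\<bar> \<le> (if i = 1 then \<gamma> else beta_max df)"
      using i df1[OF x] \<gamma> by (auto simp: three)
  next
    show "(\<Prod>i<3::nat. if i = 1 then \<gamma> else beta_max df) < 1"
      using assms(11) by (simp add: numeral_3_eq_3 power2_eq_square ac_simps)
  qed
  show ?thesis
    unfolding assms(4,5) using maximal_entropy_iff_graph_measure central_exponent_negative by auto
qed

end
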